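(* Let $n\ge 2$ and $\alpha\ge 0$. There exists a constant $s_0=s_0(n,\alpha)>0$, depending only on $n$ and $\alpha$, such that: (1) the order $\lambda_\alpha=\sup_{f\in\mathcal F_\alpha}|\nabla J_f(0)|$ is finite and $\lambda_\alpha\le 1/s_0$; (2) the image of every mapping $g\in\mathcal F_\alpha^0$ contains the Euclidean ball $\{w\in\mathbb C^n:|w|<s_0\}$; (3) the image $f(\mathbb P^n)$ of every mapping $f\in\mathcal F_\alpha$ contains the Euclidean ball $\{w\in\mathbb C^n:|w|<s_0/2\}$.
   Context: $\mathbb P^n=\{z\in\mathbb C^n:|z_i|<1,\ i=1,\dots,n\}$ is the unit polydisk; $|\cdot|$ is the Euclidean norm. For a locally biholomorphic $f=(f_1,\dots,f_n)$ with complex Jacobian determinant $J_f=\det Df$, the Schwarzian derivatives are $$S^k_{ij}f=\sum_{l=1}^n\frac{\partial^2 f_l}{\partial z_i\partial z_j}\frac{\partial z_k}{\partial f_l}-\frac1{n+1}\Big(\delta^k_i\frac{\partial}{\partial z_j}+\delta^k_j\frac{\partial}{\partial z_i}\Big)\log J_f,\qquad i,j,k=1,\dots,n,$$ where $\partial z_k/\partial f_l$ is the $(k,l)$ entry of $(Df)^{-1}$. The Schwarzian operator is $S_f(z)(\vec v)=(\vec v^{\,t}S^1_f(z)\vec v,\dots,\vec v^{\,t}S^n_f(z)\vec v)$, where $S^k_f=(S^k_{ij}f)_{i,j}$. The Bergman norm of $\vec v\in T_z\mathbb P^n$ is $\|\vec v\|=\big[2\sum_i|v_i|^2/(1-|z_i|^2)^2\big]^{1/2}$;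 $\|S_f(z)\|=\sup_{\|\vec v\|=1}\|S_f(z)(\vec v)\|$ and $\|S_f\|=\sup_{z\in\mathbb P^n}\|S_f(z)\|$. $\mathcal F_\alpha$ is the set of locally biholomorphic $f:\mathbb P^n\to\mathbb C^n$ with $f(0)=0$, $Df(0)=I$, $\|S_f\|\le\alpha$. $\mathcal F^0_\alpha$ is the set of mappings $g=T_a\circ f$ with $f\in\mathcal F_\alpha$, $(n+1)a=\nabla J_f(0)$ and $T_a(w)=w/(1+a_1w_1+\dots+a_nw_n)$ (so that $g(0)=0$, $Dg(0)=I$, $\nabla J_g(0)=0$). Such a $g$ is defined and locally biholomorphic on $\mathbb P^n$ minus the (possibly empty) singular set $\{1+a_1f_1+\dots+a_nf_n=0\}$; its image is the image of this complement. *)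

theory Defs
  imports "HOL-Complex_Analysis.Complex_Analysis"
begin

definition polydisk :: "(complex ^ 'n) set" where
  "polydisk = {z. \<forall>i. cmod (z $ i) < 1}"

text \<open>Intended for open \<open>U\<close>: the Frechet derivative exists at every point of \<open>U\<close> and is
  complex linear, i.e. given by a complex matrix.\<close>

definition holomorphic_map_on ::
    "(complex ^ 'n \<Rightarrow> complex ^ 'm) \<Rightarrow> (complex ^ 'n) set \<Rightarrow> bool" where
  "holomorphic_map_on f U \<longleftrightarrow>
     (\<forall>z\<in>U. \<exists>A :: complex ^ 'n ^ 'm. (f has_derivative (\<lambda>v. A *v v)) (at z))"

definition locally_biholomorphic_on ::
    "(complex ^ 'n \<Rightarrow> complex ^ 'n) \<Rightarrow> (complex ^ 'n) set \<Rightarrow> bool" where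
  "locally_biholomorphic_on f U \<longleftrightarrow>
     (\<forall>z\<in>U. \<exists>V. open V \<and> z \<in> V \<and> V \<subseteq> U \<and> inj_on f V \<and> open (f ` V) \<and>
        holomorphic_map_on f V \<and> holomorphic_map_on (inv_into V f) (f ` V))"

definition cpartial :: "'n \<Rightarrow> (complex ^ 'n \<Rightarrow> complex) \<Rightarrow> complex ^ 'n \<Rightarrow> complex" where
  "cpartial j h z = deriv (\<lambda>t. h (z + t *s axis j 1)) 0"

definition cgrad :: "(complex ^ 'n \<Rightarrow> complex) \<Rightarrow> complex ^ 'n \<Rightarrow> complex ^ 'n" where
  "cgrad h z = (\<chi> j. cpartial j h z)"

definition cjacobian :: "(complex ^ 'n \<Rightarrow> complex ^ 'n) \<Rightarrow> complex ^ 'n \<Rightarrow> complex ^ 'n ^ 'n" where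
  "cjacobian f z = (\<chi> l i. cpartial i (\<lambda>w. f w $ l) z)"

definition jac_det :: "(complex ^ 'n \<Rightarrow> complex ^ 'n) \<Rightarrow> complex ^ 'n \<Rightarrow> complex" where
  "jac_det f z = det (cjacobian f z)"

text \<open>The partial derivative of \<open>log h\<close>, for any local branch of the logarithm; composing with the
  principal branch \<open>Ln\<close> instead would be wrong where \<open>h\<close> takes negative real values.\<close>

definition log_cpartial :: "'n \<Rightarrow> (complex ^ 'n \<Rightarrow> complex) \<Rightarrow> complex ^ 'n \<Rightarrow> complex" where
  "log_cpartial j h z = cpartial j h z / h z"

definition schwarzian_deriv ::
    "'n \<Rightarrow> 'n \<Rightarrow> 'n \<Rightarrow> (complex ^ 'n \<Rightarrow> complex ^ 'n) \<Rightarrow> complex ^ 'n \<Rightarrow> complex" where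
  "schwarzian_deriv k i j f z =
     (\<Sum>l\<in>UNIV. cpartial i (cpartial j (\<lambda>w. f w $ l)) z * matrix_inv (cjacobian f z) $ k $ l)
     - 1 / of_nat (CARD('n) + 1) *
       ((if k = i then 1 else 0) * log_cpartial j (jac_det f) z
        + (if k = j then 1 else 0) * log_cpartial i (jac_det f) z)"

text \<open>The \<open>k\<close>-th component is the complex bilinear form \<open>v\<^sup>t S\<^sup>k v\<close>, without conjugation.\<close>

definition schwarzian_op ::
    "(complex ^ 'n \<Rightarrow> complex ^ 'n) \<Rightarrow> complex ^ 'n \<Rightarrow> complex ^ 'n \<Rightarrow> complex ^ 'n" where
  "schwarzian_op f z v =
     (\<chi> k. \<Sum>i\<in>UNIV. \<Sum>j\<in>UNIV. v $ i * schwarzian_deriv k i j f z * v $ j)"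

definition bergman_norm :: "complex ^ 'n \<Rightarrow> complex ^ 'n \<Rightarrow> real" where
  "bergman_norm z v = sqrt (2 * (\<Sum>i\<in>UNIV. (cmod (v $ i))\<^sup>2 / (1 - (cmod (z $ i))\<^sup>2)\<^sup>2))"

text \<open>Suprema are taken in the extended reals, so that an unbounded supremum is \<open>\<infinity>\<close>.\<close>

definition schwarzian_norm_at ::
    "(complex ^ 'n \<Rightarrow> complex ^ 'n) \<Rightarrow> complex ^ 'n \<Rightarrow> ereal" where
  "schwarzian_norm_at f z =
     (SUP v \<in> {v. bergman_norm z v = 1}. ereal (bergman_norm z (schwarzian_op f z v)))"

definition schwarzian_norm :: "(complex ^ 'n \<Rightarrow> complex ^ 'n) \<Rightarrow> ereal" where
  "schwarzian_norm f = (SUP z \<in> polydisk. schwarzian_norm_at f z)"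

text \<open>Members are total functions, of which only the values on the polydisk matter.\<close>

definition schwarz_family :: "real \<Rightarrow> (complex ^ 'n \<Rightarrow> complex ^ 'n) set" where
  "schwarz_family \<alpha> = {f. locally_biholomorphic_on f polydisk \<and> f 0 = 0 \<and>
     cjacobian f 0 = mat 1 \<and> schwarzian_norm f \<le> ereal \<alpha>}"

definition family_order :: "(complex ^ 'n \<Rightarrow> complex ^ 'n) set \<Rightarrow> ereal" where
  "family_order F = (SUP f \<in> F. ereal (norm (cgrad (jac_det f) 0)))"

text \<open>A partial map, undefined on the hyperplane where the denominator vanishes.\<close>

definition proj_trans :: "complex ^ 'n \<Rightarrow> (complex ^ 'n \<rightharpoonup> complex ^ 'n)" where
  "proj_trans a w =
     (let d = 1 + (\<Sum>i\<in>UNIV. a $ i * w $ i) in if d = 0 then None else Some (inverse d *s w))"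

text \<open>The members are partial maps whose domain is the polydisk minus the singular set, so the
  image of such a \<open>g\<close> is \<open>ran g\<close>.\<close>

definition schwarz_family0 :: "real \<Rightarrow> (complex ^ 'n \<rightharpoonup> complex ^ 'n) set" where
  "schwarz_family0 \<alpha> = {proj_trans a \<circ>\<^sub>m ((Some \<circ> f) |` polydisk) | a f.
     f \<in> schwarz_family \<alpha> \<and> of_nat (CARD('n) + 1) *s a = cgrad (jac_det f) 0}"

end

theory Submission
  imports Defs
begin

text \<open>Put \<open>\<psi>\<^sub>j = \<partial>\<^sub>j log J\<^sub>f / (n + 1)\<close>, so that \<open>\<Gamma>\<^sup>k\<^sub>i\<^sub>j = S\<^sup>k\<^sub>i\<^sub>j + \<delta>\<^sup>k\<^sub>i \<psi>\<^sub>j + \<delta>\<^sup>k\<^sub>j \<psi>\<^sub>i\<close> is the flat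
  connection pulled back by \<open>f\<close>. Contracting the flatness equation gives, because \<open>n \<ge> 2\<close>,
  \<open>\<partial>\<^sub>i \<psi>\<^sub>j = \<Sum>\<^sub>k \<psi>\<^sub>k S\<^sup>k\<^sub>i\<^sub>j + \<psi>\<^sub>i \<psi>\<^sub>j + Q\<^sub>i\<^sub>j\<close> with \<open>Q\<close> a polynomial in \<open>S\<close> and its first derivatives.
  Consequently \<open>u = J\<^sub>f\<close> to the power \<open>- 1 / (n + 1)\<close> times any affine function of \<open>f\<close> solves
  \<open>\<partial>\<^sub>i \<partial>\<^sub>j u = \<Sum>\<^sub>k S\<^sup>k\<^sub>i\<^sub>j \<partial>\<^sub>k u - Q\<^sub>i\<^sub>j u\<close>, a linear system whose coefficients are bounded near the
  origin in terms of \<open>n\<close> and \<open>\<alpha>\<close> alone. The normalised mapping \<open>T\<^sub>a \<circ> f\<close> is a quotient of such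
  solutions with initial data \<open>(z\<^sub>1, \<dots>, z\<^sub>n)\<close> and \<open>1\<close>, so it is uniformly close to the identity on a fixed small
  ball, and Brouwer's theorem shows that it covers a fixed ball. The hyperplane \<open>a \<cdot> w = 1\<close>, being the
  \<open>T\<^sub>a\<close>-image of infinity, is never met, which bounds \<open>a\<close> and hence the order.\<close>

section \<open>Complex differentiable functions of several variables\<close>

text \<open>Complex linearity is carried by the coefficient vector \<open>c\<close>. Only pointwise
  differentiability is demanded; on open sets the regularity of \<open>cpartial j h\<close> is
  derived below.\<close>

definition cdiff_on :: "(complex ^ 'n \<Rightarrow> complex) \<Rightarrow> (complex ^ 'n) set \<Rightarrow> bool" where
  "cdiff_on h U \<longleftrightarrow> (\<forall>z\<in>U. \<exists>c. (h has_derivative (\<lambda>v. \<Sum>i\<in>UNIV. c $ i * v $ i)) (at z))"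

lemma norm_cvec_scale: "norm (c *s (v :: complex ^ 'n)) = cmod c * norm v"
  by (simp add: norm_vec_def L2_set_def norm_mult power_mult_distrib real_sqrt_mult
      flip: sum_distrib_left)

lemma bounded_linear_cvec_scale: "bounded_linear (\<lambda>t. t *s (v :: complex ^ 'n))"
proof (rule bounded_linear_intro[where K = "norm v"])
  show "(r *\<^sub>R x) *s v = r *\<^sub>R (x *s v)" for r and x :: complex
    by (simp add: vec_eq_iff)
qed (simp_all add: vector_sadd_rdistrib norm_cvec_scale)

lemma has_derivative_line:
  fixes z v :: "complex ^ 'n"
  shows "((\<lambda>t. z + t *s v) has_derivative (\<lambda>t. t *s v)) (at t)"
  using has_derivative_add[OF has_derivative_const bounded_linear_imp_has_derivative
      [OF bounded_linear_cvec_scale]] by force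

lemma has_field_derivative_line:
  fixes h :: "complex ^ 'n \<Rightarrow> complex"
  assumes "(h has_derivative (\<lambda>v. \<Sum>i\<in>UNIV. c $ i * v $ i)) (at (z + t *s v))"
  shows "((\<lambda>t. h (z + t *s v)) has_field_derivative (\<Sum>i\<in>UNIV. c $ i * v $ i)) (at t)"
proof -
  have "((\<lambda>t. h (z + t *s v)) has_derivative (\<lambda>t. \<Sum>i\<in>UNIV. c $ i * (t *s v) $ i)) (at t)"
    by (rule has_derivative_compose[OF has_derivative_line assms])
  moreover have "(\<lambda>t. \<Sum>i\<in>UNIV. c $ i * (t *s v) $ i) = (*) (\<Sum>i\<in>UNIV. c $ i * v $ i)"
    by (rule ext) (simp add: sum_distrib_left sum_distrib_right mult_ac)
  ultimately show ?thesis
    by (simp add: has_field_derivative_def)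
qed

lemma cpartial_eqI:
  assumes "(h has_derivative (\<lambda>v. \<Sum>i\<in>UNIV. c $ i * v $ i)) (at z)"
  shows "cpartial j h z = c $ j"
proof -
  have "((\<lambda>t. h (z + t *s axis j 1)) has_field_derivative (\<Sum>i\<in>UNIV. c $ i * axis j 1 $ i)) (at 0)"
    by (rule has_field_derivative_line) (use assms in simp)
  then show ?thesis
    unfolding cpartial_def by (simp add: DERIV_imp_deriv axis_def if_distrib cong: if_cong)
qed

lemma cdiff_onD:
  assumes "cdiff_on h U" "z \<in> U"
  shows "(h has_derivative (\<lambda>v. \<Sum>i\<in>UNIV. cpartial i h z * v $ i)) (at z)"
  using assms cpartial_eqI unfolding cdiff_on_def by force

text \<open>A real-linear map commuting with complex scalars is determined by its values on the
  axes, and these supply the coefficient vector.\<close>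

lemma cdiff_onI:
  assumes "\<And>z. z \<in> U \<Longrightarrow> \<exists>L. (h has_derivative L) (at z) \<and> (\<forall>c v. L (c *s v) = c * L v)"
  shows "cdiff_on h U"
  unfolding cdiff_on_def
proof
  fix z assume "z \<in> U"
  then obtain L where L: "(h has_derivative L) (at z)" "\<And>c v. L (c *s v) = c * L v"
    using assms by blast
  interpret L: bounded_linear L using L(1) by (rule has_derivative_bounded_linear)
  have "L v = (\<Sum>i\<in>UNIV. (\<chi> i. L (axis i 1)) $ i * v $ i)" for v
  proof -
    have "L v = L (\<Sum>i\<in>UNIV. (v $ i) *s axis i 1)"
      by (simp add: basis_expansion)
    also have "\<dots> = (\<Sum>i\<in>UNIV. v $ i * L (axis i 1))"
      by (simp add: L.sum L(2))
    finally show ?thesis by (simp add: mult.commute)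
  qed
  then have "L = (\<lambda>v. \<Sum>i\<in>UNIV. (\<chi> i. L (axis i 1)) $ i * v $ i)" by blast
  then show "\<exists>c. (h has_derivative (\<lambda>v. \<Sum>i\<in>UNIV. c $ i * v $ i)) (at z)"
    using L(1) by metis
qed

lemma cdiff_on_subset: "cdiff_on h U \<Longrightarrow> V \<subseteq> U \<Longrightarrow> cdiff_on h V"
  unfolding cdiff_on_def by blast

lemma cdiff_on_line:
  assumes "cdiff_on h U" "z + t *s v \<in> U"
  shows "((\<lambda>t. h (z + t *s v)) has_field_derivative
           (\<Sum>i\<in>UNIV. cpartial i h (z + t *s v) * v $ i)) (at t)"
  by (rule has_field_derivative_line[of _ "\<chi> i. cpartial i h (z + t *s v)", simplified]) 
     (rule cdiff_onD[OF assms])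

lemma cdiff_on_axis:
  assumes "cdiff_on h U" "z \<in> U"
  shows "((\<lambda>t. h (z + t *s axis j 1)) has_field_derivative cpartial j h z) (at 0)"
  using cdiff_on_line[OF assms(1), of z 0 "axis j 1"] assms(2)
  by (simp add: axis_def if_distrib cong: if_cong)

lemma cdiff_on_imp_continuous_on: "cdiff_on h U \<Longrightarrow> continuous_on U h"
  by (meson cdiff_onD continuous_at_imp_continuous_on has_derivative_continuous)

lemma cpartial_unique:
  assumes "((\<lambda>t. h (z + t *s axis j 1)) has_field_derivative d) (at 0)"
  shows "cpartial j h z = d"
  using assms unfolding cpartial_def by (rule DERIV_imp_deriv)

section \<open>Algebraic rules for complex differentiability and partial derivatives\<close>

lemma cdiff_on_const: "cdiff_on (\<lambda>z. c) U"
  by (rule cdiff_onI) (auto intro!: exI[of _ "\<lambda>_. 0"])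

lemma cdiff_on_add:
  assumes "cdiff_on f U" "cdiff_on g U"
  shows "cdiff_on (\<lambda>z. f z + g z) U"
  by (rule cdiff_onI, rule exI, rule conjI, rule has_derivative_add)
     (use assms in \<open>auto intro!: cdiff_onD simp: sum_distrib_left algebra_simps\<close>)

lemma cdiff_on_mult:
  assumes "cdiff_on f U" "cdiff_on g U"
  shows "cdiff_on (\<lambda>z. f z * g z) U"
  by (rule cdiff_onI, rule exI, rule conjI, rule has_derivative_mult)
     (use assms in \<open>auto intro!: cdiff_onD simp: sum_distrib_left algebra_simps\<close>)

lemma cdiff_on_sum:
  assumes "\<And>i. i \<in> I \<Longrightarrow> cdiff_on (f i) U"
  shows "cdiff_on (\<lambda>z. \<Sum>i\<in>I. f i z) U"
  using assms by (induction I rule: infinite_finite_induct)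
    (auto intro: cdiff_on_const cdiff_on_add)

lemma cdiff_on_prod:
  assumes "\<And>i. i \<in> I \<Longrightarrow> cdiff_on (f i) U"
  shows "cdiff_on (\<lambda>z. \<Prod>i\<in>I. f i z) U"
  using assms by (induction I rule: infinite_finite_induct)
    (auto intro: cdiff_on_const cdiff_on_mult)

lemma cdiff_on_inverse:
  assumes "cdiff_on f U" "\<And>z. z \<in> U \<Longrightarrow> f z \<noteq> 0"
  shows "cdiff_on (\<lambda>z. inverse (f z)) U"
proof (rule cdiff_onI)
  fix z assume z: "z \<in> U"
  have "((\<lambda>z. inverse (f z)) has_derivative
      (\<lambda>h. - (inverse (f z) * (\<Sum>i\<in>UNIV. cpartial i f z * h $ i) * inverse (f z)))) (at z)"
    by (rule Deriv.has_derivative_inverse[OF assms(2)[OF z] cdiff_onD[OF assms(1) z]])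
  then show "\<exists>L. ((\<lambda>z. inverse (f z)) has_derivative L) (at z) \<and> (\<forall>c v. L (c *s v) = c * L v)"
    by (intro exI conjI) (assumption, simp add: sum_distrib_left sum_distrib_right algebra_simps)
qed

lemma cdiff_on_divide:
  assumes "cdiff_on f U" "cdiff_on g U" "\<And>z. z \<in> U \<Longrightarrow> g z \<noteq> 0"
  shows "cdiff_on (\<lambda>z. f z / g z) U"
  using cdiff_on_mult[OF assms(1) cdiff_on_inverse[OF assms(2,3)]] by (simp add: divide_inverse)

lemma cdiff_on_minus: "cdiff_on f U \<Longrightarrow> cdiff_on (\<lambda>z. - f z) U"
  using cdiff_on_mult[OF cdiff_on_const[of "-1"], of f U] by simp

lemma cdiff_on_diff: "cdiff_on f U \<Longrightarrow> cdiff_on g U \<Longrightarrow> cdiff_on (\<lambda>z. f z - g z) U"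
  using cdiff_on_add[OF _ cdiff_on_minus, of f U g] by simp

lemmas cdiff_on_intros = cdiff_on_const cdiff_on_add cdiff_on_mult cdiff_on_sum
  cdiff_on_prod cdiff_on_divide cdiff_on_minus cdiff_on_diff

lemma cpartial_const: "cpartial j (\<lambda>_. c) z = 0"
  unfolding cpartial_def by simp

lemma cpartial_add:
  assumes "cdiff_on f U" "cdiff_on g U" "z \<in> U"
  shows "cpartial j (\<lambda>z. f z + g z) z = cpartial j f z + cpartial j g z"
  by (rule cpartial_unique) (intro DERIV_add cdiff_on_axis[OF _ assms(3)] assms)

lemma cpartial_diff:
  assumes "cdiff_on f U" "cdiff_on g U" "z \<in> U"
  shows "cpartial j (\<lambda>z. f z - g z) z = cpartial j f z - cpartial j g z"
  by (rule cpartial_unique) (intro DERIV_diff cdiff_on_axis[OF _ assms(3)] assms)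

lemma cpartial_mult:
  assumes "cdiff_on f U" "cdiff_on g U" "z \<in> U"
  shows "cpartial j (\<lambda>z. f z * g z) z = cpartial j f z * g z + f z * cpartial j g z"
  using DERIV_mult[OF cdiff_on_axis[OF assms(1,3)] cdiff_on_axis[OF assms(2,3)], of j j]
  by (intro cpartial_unique) (simp add: mult.commute)

lemma cpartial_cmult:
  assumes "cdiff_on f U" "z \<in> U"
  shows "cpartial j (\<lambda>z. c * f z) z = c * cpartial j f z"
  using cpartial_mult[OF cdiff_on_const assms] by (simp add: cpartial_const)

lemma cpartial_sum:
  assumes "\<And>i. i \<in> I \<Longrightarrow> cdiff_on (f i) U" "z \<in> U"
  shows "cpartial j (\<lambda>z. \<Sum>i\<in>I. f i z) z = (\<Sum>i\<in>I. cpartial j (f i) z)"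
  by (rule cpartial_unique) (intro DERIV_sum cdiff_on_axis[OF _ assms(2)] assms)

lemma cpartial_cong:
  assumes "open U" "z \<in> U" "\<And>w. w \<in> U \<Longrightarrow> f w = g w"
  shows "cpartial j f z = cpartial j g z"
proof -
  have "isCont (\<lambda>t. z + t *s axis j 1) 0"
    using has_derivative_line has_derivative_continuous by blast
  then have "((\<lambda>t. z + t *s axis j 1) \<longlongrightarrow> z + 0 *s axis j 1) (nhds 0)"
    unfolding isCont_def by (rule tendsto_at_iff_tendsto_nhds[THEN iffD1])
  then have "((\<lambda>t. z + t *s axis j 1) \<longlongrightarrow> z) (nhds 0)"
    by simp
  then have "\<forall>\<^sub>F t in nhds 0. z + t *s axis j 1 \<in> U"
    using assms(1,2) by (rule topological_tendstoD)
  then have "\<forall>\<^sub>F t in nhds 0. f (z + t *s axis j 1) = g (z + t *s axis j 1)"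
    by eventually_elim (rule assms(3))
  then show ?thesis
    unfolding cpartial_def by (intro deriv_cong_ev) simp_all
qed

lemma cdiff_on_cong:
  assumes "open U" "\<And>w. w \<in> U \<Longrightarrow> f w = g w" "cdiff_on f U"
  shows "cdiff_on g U"
  unfolding cdiff_on_def
proof
  fix z assume z: "z \<in> U"
  obtain c where "(f has_derivative (\<lambda>v. \<Sum>i\<in>UNIV. c $ i * v $ i)) (at z)"
    using assms(3) z unfolding cdiff_on_def by blast
  then have "(g has_derivative (\<lambda>v. \<Sum>i\<in>UNIV. c $ i * v $ i)) (at z)"
    by (rule has_derivative_transform_within_open[OF _ assms(1) z assms(2)])
  then show "\<exists>c. (g has_derivative (\<lambda>v. \<Sum>i\<in>UNIV. c $ i * v $ i)) (at z)" by blast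
qed

section \<open>Existence and symmetry of second derivatives\<close>

lemma holomorphic_linear_approx:
  assumes hol: "k holomorphic_on ball 0 R" and R: "R > 0"
    and M: "\<And>x. x \<in> ball 0 R \<Longrightarrow> cmod (k x) \<le> M" and t: "cmod t \<le> R / 2"
  shows "cmod (k t - k 0 - t * deriv k 0) \<le> 32 * M / R\<^sup>2 * (cmod t)\<^sup>2"
proof -
  have ball: "cball x (R / 4) \<subseteq> ball 0 R" if "x \<in> cball 0 (R / 2)" for x :: complex
  proof
    fix y assume "y \<in> cball x (R / 4)"
    moreover have "cmod y \<le> cmod x + cmod (y - x)"
      by (metis add_diff_cancel_left' diff_add_cancel norm_triangle_ineq)
    ultimately show "y \<in> ball 0 R" using that R by (simp add: dist_norm norm_minus_commute)
  qed
  have "((deriv ^^ i) k has_field_derivative (deriv ^^ Suc i) k x) (at x within cball 0 (R / 2))"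
    if "x \<in> cball 0 (R / 2)" for i x
  proof -
    have "x \<in> ball 0 R" using that R by simp
    then have "((deriv ^^ i) k has_field_derivative deriv ((deriv ^^ i) k) x) (at x)"
      using holomorphic_higher_deriv[OF hol open_ball] holomorphic_derivI open_ball by blast
    then show ?thesis by (simp add: has_field_derivative_at_within)
  qed
  \<comment> \<open>Discs of radius \<open>R / 4\<close> about points of
    \<open>cball 0 (R / 2)\<close> stay inside \<open>ball 0 R\<close>, so Cauchy's inequality
    bounds the second derivative by \<open>2 * M\<close> over the square of
    \<open>R / 4\<close>.\<close>
  moreover have "cmod ((deriv ^^ Suc 1) k x) \<le> 32 * M / R\<^sup>2" if "x \<in> cball 0 (R / 2)" for x
  proof -
    have "norm ((deriv ^^ Suc 1) k x) \<le> fact (Suc 1) * M / (R / 4) ^ Suc 1"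
    proof (rule Cauchy_inequality)
      show "k holomorphic_on ball x (R / 4)"
        using hol ball[OF that] ball_subset_cball holomorphic_on_subset by blast
      show "continuous_on (cball x (R / 4)) k"
        using hol ball[OF that] holomorphic_on_imp_continuous_on holomorphic_on_subset by blast
      show "cmod (k y) \<le> M" if "cmod (x - y) = R / 4" for y
        using M ball[OF \<open>x \<in> _\<close>] that by (auto simp: dist_norm subset_iff)
    qed (use R in simp)
    also have "\<dots> = 32 * M / R\<^sup>2"
      using R by (simp add: power2_eq_square field_simps)
    finally show ?thesis .
  qed
  ultimately have "cmod ((deriv ^^ 0) k t - (\<Sum>i\<le>1. (deriv ^^ i) k 0 * (t - 0) ^ i / fact i))
      \<le> 32 * M / R\<^sup>2 * cmod (t - 0) ^ Suc 1 / fact 1"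
    by (intro complex_Taylor[where S = "cball 0 (R / 2)"]) (use t R in auto)
  then show ?thesis
    by (simp add: power2_eq_square algebra_simps)
qed

lemma line_in_ball:
  fixes z0 v :: "complex ^ 'n"
  assumes "z \<in> ball z0 a" "norm v \<le> 1" "cmod t < b"
  shows "z + t *s v \<in> ball z0 (a + b)"
proof -
  have "dist z0 (z + t *s v) \<le> dist z0 z + norm (t *s v)"
    by (metis dist_norm dist_triangle add_diff_cancel_left' norm_minus_commute)
  also have "norm (t *s v) \<le> cmod t * 1"
    unfolding norm_cvec_scale using assms(2) by (intro mult_left_mono) auto
  finally show ?thesis using assms by simp
qed

text \<open>The difference quotients of \<open>h\<close> in direction \<open>e\<close> are holomorphic along \<open>v\<close> and converge uniformly, so
  differentiation along \<open>v\<close> passes to the limit. Exchanging \<open>e\<close> and \<open>v\<close> then gives the symmetry of the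
  second derivatives.\<close>

lemma uniform_dir_derivative:
  fixes h :: "complex ^ 'n \<Rightarrow> complex" and z0 e v :: "complex ^ 'n"
    and D :: "complex ^ 'n \<Rightarrow> complex ^ 'n \<Rightarrow> complex"
  defines "D \<equiv> \<lambda>e z. \<Sum>i\<in>UNIV. cpartial i h z * e $ i"
  assumes h: "cdiff_on h (ball z0 (4 * \<rho>))" and \<rho>: "\<rho> > 0"
    and M: "\<And>z. z \<in> ball z0 (4 * \<rho>) \<Longrightarrow> cmod (h z) \<le> M"
    and e: "norm e \<le> 1" and v: "norm v \<le> 1"
  obtains g' where
    "\<And>s. cmod s < \<rho> \<Longrightarrow> ((\<lambda>s. D e (z0 + s *s v)) has_field_derivative g' s) (at s)"
    "\<And>s. cmod s < \<rho> \<Longrightarrow> cmod (D e (z0 + s *s v)) \<le> M / \<rho>"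
    "(\<lambda>k. (D v (z0 + (\<rho> / Suc k) *s e) - D v z0) / (\<rho> / Suc k)) \<longlonglongrightarrow> g' 0"
proof -
  have line: "((\<lambda>t. h (z + t *s e)) has_field_derivative D e (z + t *s e)) (at t)"
    if "z + t *s e \<in> ball z0 (4 * \<rho>)" for z t e
    unfolding D_def using h that by (rule cdiff_on_line)
  \<comment> \<open>Radius bookkeeping: a base point within \<open>2 * \<rho>\<close> of
    \<open>z0\<close> and a parameter of modulus below \<open>2 * \<rho>\<close> keep the slice
    inside \<open>ball z0 (4 * \<rho>)\<close>.\<close>
  have hol: "(\<lambda>t. h (z + t *s e)) holomorphic_on ball 0 (2 * \<rho>)"
    and bd: "\<And>t. t \<in> ball 0 (2 * \<rho>) \<Longrightarrow> cmod (h (z + t *s e)) \<le> M"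
    and der: "deriv (\<lambda>t. h (z + t *s e)) 0 = D e z"
    if "z \<in> ball z0 (2 * \<rho>)" "norm e \<le> 1" for z e
  proof -
    have in4: "z + t *s e \<in> ball z0 (4 * \<rho>)" if "t \<in> ball 0 (2 * \<rho>)" for t
      using line_in_ball[OF \<open>z \<in> _\<close> \<open>norm e \<le> 1\<close>, of t "2 * \<rho>"] that by simp
    show "(\<lambda>t. h (z + t *s e)) holomorphic_on ball 0 (2 * \<rho>)"
      unfolding holomorphic_on_open[OF open_ball] using line in4 by blast
    show "cmod (h (z + t *s e)) \<le> M" if "t \<in> ball 0 (2 * \<rho>)" for t
      using M in4[OF that] by blast
    show "deriv (\<lambda>t. h (z + t *s e)) 0 = D e z"
      using DERIV_imp_deriv[OF line[OF in4, of 0]] \<rho> by simp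
  qed
  \<comment> \<open>The Taylor estimate with radius \<open>2 * \<rho>\<close>; the constant depends
    neither on \<open>z\<close> nor on \<open>t\<close>, which makes the later convergence
    uniform.\<close>
  have approx: "cmod (h (z + t *s e) - h z - t * D e z) \<le> 8 * M / \<rho>\<^sup>2 * (cmod t)\<^sup>2"
    if z: "z \<in> ball z0 (2 * \<rho>)" "cmod t \<le> \<rho>" for z t
    using holomorphic_linear_approx[OF hol[OF z(1) e] _ bd[OF z(1) e], of t] der[OF z(1) e] \<rho> z(2)
    by (simp add: power2_eq_square field_simps)
  have Dbd: "cmod (D e z) \<le> M / \<rho>" if z: "z \<in> ball z0 (2 * \<rho>)" for z
  proof -
    have "cmod ((deriv ^^ 1) (\<lambda>t. h (z + t *s e)) 0) \<le> fact 1 * M / \<rho> ^ 1"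
    proof (rule Cauchy_inequality)
      show "continuous_on (cball 0 \<rho>) (\<lambda>t. h (z + t *s e))"
        using hol[OF z e] \<rho> by (intro holomorphic_on_imp_continuous_on)
          (auto elim!: holomorphic_on_subset)
      show "(\<lambda>t. h (z + t *s e)) holomorphic_on ball 0 \<rho>"
        using hol[OF z e] \<rho> by (auto elim!: holomorphic_on_subset)
    qed (use \<rho> bd[OF z e] in auto)
    then show ?thesis using der[OF z e] by simp
  qed
  define \<delta> :: "nat \<Rightarrow> complex" where "\<delta> k = of_real (\<rho> / Suc k)" for k
  have \<delta>: "\<delta> k \<noteq> 0" "cmod (\<delta> k) = \<rho> / Suc k" "cmod (\<delta> k) \<le> \<rho>" for k
    using \<rho> by (auto simp: \<delta>_def norm_divide field_simps simp del: of_nat_Suc)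
  have \<delta>0: "(\<lambda>k. cmod (\<delta> k)) \<longlonglongrightarrow> 0"
    unfolding \<delta> using LIMSEQ_Suc[OF lim_const_over_n[of \<rho>]] by simp
  \<comment> \<open>\<open>q k\<close> is the difference quotient of \<open>h\<close> in direction
    \<open>e\<close> along the line with direction \<open>v\<close>. Its \<open>s\<close>-derivative
    \<open>q' k\<close> is the corresponding quotient of \<open>D v\<close>; here the two orders of
    differentiation meet.\<close>
  define q where "q k s = (h (z0 + s *s v + \<delta> k *s e) - h (z0 + s *s v)) / \<delta> k" for k s
  define q' where "q' k s = (D v (z0 + s *s v + \<delta> k *s e) - D v (z0 + s *s v)) / \<delta> k" for k s
  have in2: "z0 + s *s v \<in> ball z0 (2 * \<rho>)" if "s \<in> ball 0 \<rho>" for s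
    using line_in_ball[of z0 z0 \<rho> v s \<rho>] v \<rho> that by simp
  have q': "(q k has_field_derivative q' k s) (at s)" if s: "s \<in> ball 0 \<rho>" for k s
  proof -
    have "z0 + s *s v + \<delta> k *s e \<in> ball z0 (2 * \<rho> + 2 * \<rho>)"
      by (rule line_in_ball[OF in2[OF s] e]) (use \<delta>(3)[of k] \<rho> in linarith)
    then have "((\<lambda>s. h ((z0 + \<delta> k *s e) + s *s v)) has_field_derivative
        D v ((z0 + \<delta> k *s e) + s *s v)) (at s)"
      by (intro line) (simp add: add_ac)
    moreover have "((\<lambda>s. h (z0 + s *s v)) has_field_derivative D v (z0 + s *s v)) (at s)"
      by (intro line) (use in2[OF s] \<rho> in simp)
    ultimately show ?thesis
      unfolding q_def q'_def by (intro DERIV_cdivide DERIV_diff) (simp_all add: add_ac)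
  qed
  have ul: "uniform_limit (ball 0 \<rho>) q (\<lambda>s. D e (z0 + s *s v)) sequentially"
  proof (rule uniform_limitI)
    fix \<epsilon> :: real assume "\<epsilon> > 0"
    have "(\<lambda>k. 8 * M / \<rho>\<^sup>2 * cmod (\<delta> k)) \<longlonglongrightarrow> 8 * M / \<rho>\<^sup>2 * 0"
      by (intro tendsto_intros \<delta>0)
    then have "\<forall>\<^sub>F k in sequentially. 8 * M / \<rho>\<^sup>2 * cmod (\<delta> k) < \<epsilon>"
      using \<open>\<epsilon> > 0\<close> by (intro order_tendstoD(2)) auto
    then show "\<forall>\<^sub>F k in sequentially. \<forall>s\<in>ball 0 \<rho>. dist (q k s) (D e (z0 + s *s v)) < \<epsilon>"
    proof eventually_elim
      case (elim k)
      show ?case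
      proof
        fix s :: complex assume s: "s \<in> ball 0 \<rho>"
        let ?z = "z0 + s *s v"
        have "q k s - D e ?z = (h (?z + \<delta> k *s e) - h ?z - \<delta> k * D e ?z) / \<delta> k"
          using \<delta>(1) by (simp add: q_def diff_divide_distrib)
        then have "dist (q k s) (D e ?z) = cmod (h (?z + \<delta> k *s e) - h ?z - \<delta> k * D e ?z) / cmod (\<delta> k)"
          by (simp add: dist_norm norm_divide)
        also have "\<dots> \<le> (8 * M / \<rho>\<^sup>2 * (cmod (\<delta> k))\<^sup>2) / cmod (\<delta> k)"
          by (intro divide_right_mono approx in2 s \<delta>) simp
        also have "\<dots> = 8 * M / \<rho>\<^sup>2 * cmod (\<delta> k)"
          using \<delta>(1) by (simp add: power2_eq_square)
        finally show "dist (q k s) (D e ?z) < \<epsilon>" using elim by linarith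
      qed
    qed
  qed
  have "\<exists>g'. \<forall>s\<in>ball 0 \<rho>. ((\<lambda>s. D e (z0 + s *s v)) has_field_derivative g' s) (at s) \<and>
      (\<lambda>k. q' k s) \<longlonglongrightarrow> g' s"
  proof (rule has_complex_derivative_uniform_sequence[OF open_ball q'])
    fix x :: complex assume "x \<in> ball 0 \<rho>"
    then obtain d where "d > 0" "cball x d \<subseteq> ball 0 \<rho>"
      using open_contains_cball open_ball by blast
    then show "\<exists>d>0. cball x d \<subseteq> ball 0 \<rho> \<and>
        uniform_limit (cball x d) q (\<lambda>s. D e (z0 + s *s v)) sequentially"
      using uniform_limit_on_subset[OF ul] by blast
  qed
  then obtain g' where g': "\<And>s. s \<in> ball 0 \<rho> \<Longrightarrow>
      ((\<lambda>s. D e (z0 + s *s v)) has_field_derivative g' s) (at s) \<and> (\<lambda>k. q' k s) \<longlonglongrightarrow> g' s"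
    by blast
  show ?thesis
  proof (rule that[of g'])
    show "(\<lambda>k. (D v (z0 + (\<rho> / Suc k) *s e) - D v z0) / (\<rho> / Suc k)) \<longlonglongrightarrow> g' 0"
      using g'[of 0] \<rho> by (simp add: q'_def \<delta>_def)
    show "cmod (D e (z0 + s *s v)) \<le> M / \<rho>" if "cmod s < \<rho>" for s
      using that by (intro Dbd in2) simp
  qed (use g' in auto)
qed

text \<open>The quotients of \<open>D v\<close> with steps \<open>\<rho> / Suc k\<close> in
  direction \<open>e\<close> tend to the derivative of \<open>D e\<close> along \<open>v\<close>.
  With the roles exchanged, \<open>D v\<close> is known to be differentiable along \<open>e\<close>,
  so the same sequence also tends to that derivative.\<close>

lemma dir_derivative_commute:
  fixes h :: "complex ^ 'n \<Rightarrow> complex" and z0 e v :: "complex ^ 'n"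
    and D :: "complex ^ 'n \<Rightarrow> complex ^ 'n \<Rightarrow> complex"
  defines "D \<equiv> \<lambda>e z. \<Sum>i\<in>UNIV. cpartial i h z * e $ i"
  assumes h: "cdiff_on h (ball z0 (4 * \<rho>))" and \<rho>: "\<rho> > 0"
    and M: "\<And>z. z \<in> ball z0 (4 * \<rho>) \<Longrightarrow> cmod (h z) \<le> M"
    and e: "norm e \<le> 1" and v: "norm v \<le> 1"
  obtains c where
    "((\<lambda>s. D e (z0 + s *s v)) has_field_derivative c) (at 0)"
    "((\<lambda>s. D v (z0 + s *s e)) has_field_derivative c) (at 0)"
proof -
  obtain g1 where g1:
    "\<And>s. cmod s < \<rho> \<Longrightarrow> ((\<lambda>s. D e (z0 + s *s v)) has_field_derivative g1 s) (at s)"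
    "(\<lambda>k. (D v (z0 + (\<rho> / Suc k) *s e) - D v z0) / (\<rho> / Suc k)) \<longlonglongrightarrow> g1 0"
    unfolding D_def by (rule uniform_dir_derivative[OF h \<rho> M e v]) blast+
  obtain g2 where g2:
    "\<And>s. cmod s < \<rho> \<Longrightarrow> ((\<lambda>s. D v (z0 + s *s e)) has_field_derivative g2 s) (at s)"
    unfolding D_def by (rule uniform_dir_derivative[OF h \<rho> M v e]) blast+
  have "((\<lambda>s. (D v (z0 + s *s e) - D v z0) / s) \<longlongrightarrow> g2 0) (at 0)"
    using g2[of 0] \<rho> by (simp add: has_field_derivative_iff)
  moreover have "filterlim (\<lambda>k. complex_of_real (\<rho> / Suc k)) (at 0) sequentially"
  proof (rule filterlim_atI)
    have "(\<lambda>k. complex_of_real (\<rho> / Suc k)) \<longlonglongrightarrow> complex_of_real 0"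
      using LIMSEQ_Suc[OF lim_const_over_n[of \<rho>]] by (intro tendsto_of_real) simp
    then show "(\<lambda>k. complex_of_real (\<rho> / Suc k)) \<longlonglongrightarrow> 0" by simp
  qed (use \<rho> in \<open>auto simp del: of_nat_Suc\<close>)
  ultimately have "(\<lambda>k. (D v (z0 + complex_of_real (\<rho> / Suc k) *s e) - D v z0) /
      complex_of_real (\<rho> / Suc k)) \<longlonglongrightarrow> g2 0"
    by (rule filterlim_compose)
  with g1(2) have "g1 0 = g2 0"
    by (intro LIMSEQ_unique) simp_all
  with g1(1)[of 0] g2[of 0] \<rho> show ?thesis by (intro that) auto
qed

text \<open>Continuity on a compact ball gives \<open>M\<close>; its radius is quartered to fit the
  \<open>4 * \<rho>\<close> of the slice estimates.\<close>

lemma locally_bounded_cdiff: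
  assumes h: "cdiff_on h U" and U: "open U" "z0 \<in> U"
  obtains \<rho> M where "\<rho> > 0" "ball z0 (4 * \<rho>) \<subseteq> U"
    "\<And>z. z \<in> ball z0 (4 * \<rho>) \<Longrightarrow> cmod (h z) \<le> M"
proof -
  obtain r where r: "r > 0" "cball z0 r \<subseteq> U"
    using U open_contains_cball by blast
  have "compact (h ` cball z0 r)"
    using cdiff_on_imp_continuous_on[OF cdiff_on_subset[OF h r(2)]]
    by (intro compact_continuous_image) auto
  then obtain M where "\<And>z. z \<in> cball z0 r \<Longrightarrow> cmod (h z) \<le> M"
    using compact_imp_bounded bounded_iff by (metis image_eqI)
  then show ?thesis
    using r by (intro that[of "r / 4" M]) auto
qed

lemma sum_cpartial_axis: "(\<Sum>i\<in>UNIV. cpartial i h z * axis j 1 $ i) = cpartial j h z"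
  by (simp add: axis_def if_distrib cong: if_cong)

lemma norm_axis_1: "norm (axis j (1 :: complex) :: complex ^ 'n) = 1"
  by simp

lemma cpartial_commute:
  assumes h: "cdiff_on h U" and U: "open U" "z \<in> U"
  shows "cpartial i (cpartial j h) z = cpartial j (cpartial i h) z"
proof -
  obtain \<rho> M where \<rho>: "\<rho> > 0" "ball z (4 * \<rho>) \<subseteq> U"
    and M: "\<And>w. w \<in> ball z (4 * \<rho>) \<Longrightarrow> cmod (h w) \<le> M"
    using locally_bounded_cdiff[OF h U] by blast
  obtain c where "((\<lambda>s. cpartial j h (z + s *s axis i 1)) has_field_derivative c) (at 0)"
    "((\<lambda>s. cpartial i h (z + s *s axis j 1)) has_field_derivative c) (at 0)"
    using dir_derivative_commute[OF cdiff_on_subset[OF h \<rho>(2)] \<rho>(1) M,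
        of "axis j 1" "axis i 1", unfolded sum_cpartial_axis] by auto
  then show ?thesis using cpartial_unique by metis
qed

text \<open>By symmetry, the derivative of \<open>cpartial j h\<close> along \<open>v\<close> at
  \<open>z0\<close> is the derivative along axis \<open>j\<close> of a combination of first partials
  with coefficients \<open>v $ i\<close>, hence linear in \<open>v\<close>. A quadratic remainder
  that is uniform over all directions \<open>v\<close> in the unit ball turns these derivatives
  along lines into a Frechet derivative.\<close>

lemma cdiff_on_cpartial:
  assumes h: "cdiff_on h U" and U: "open U"
  shows "cdiff_on (cpartial j h) U"
  unfolding cdiff_on_def
proof
  fix z0 assume z0: "z0 \<in> U"
  obtain \<rho> M where \<rho>: "\<rho> > 0" "ball z0 (4 * \<rho>) \<subseteq> U"
    and M: "\<And>w. w \<in> ball z0 (4 * \<rho>) \<Longrightarrow> cmod (h w) \<le> M"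
    using locally_bounded_cdiff[OF h U z0] by blast
  note h' = cdiff_on_subset[OF h \<rho>(2)]
  define c where "c = (\<chi> i. cpartial i (cpartial j h) z0)"
  have c: "((\<lambda>s. cpartial i h (z0 + s *s axis j 1)) has_field_derivative c $ i) (at 0)" for i
  proof -
    obtain d where d: "((\<lambda>s. cpartial j h (z0 + s *s axis i 1)) has_field_derivative d) (at 0)"
      "((\<lambda>s. cpartial i h (z0 + s *s axis j 1)) has_field_derivative d) (at 0)"
      using dir_derivative_commute[OF h' \<rho>(1) M, of "axis j 1" "axis i 1",
          unfolded sum_cpartial_axis] by auto
    then show ?thesis using cpartial_unique[OF d(1)] by (simp add: c_def)
  qed
  \<comment> \<open>The constant of \<open>holomorphic_linear_approx\<close> for radius
    \<open>\<rho>\<close> and the Cauchy bound \<open>M / \<rho>\<close> on first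
    derivatives.\<close>
  define K where "K = 32 * (M / \<rho>) / \<rho>\<^sup>2"
  have approx: "cmod (cpartial j h (z0 + s *s v) - cpartial j h z0 - s * (\<Sum>i\<in>UNIV. c $ i * v $ i))
      \<le> K * (cmod s)\<^sup>2" if v: "norm v \<le> 1" and s: "cmod s \<le> \<rho> / 2" for v s
  proof -
    obtain g where g:
      "\<And>s. cmod s < \<rho> \<Longrightarrow> ((\<lambda>s. cpartial j h (z0 + s *s v)) has_field_derivative g s) (at s)"
      "\<And>s. cmod s < \<rho> \<Longrightarrow> cmod (cpartial j h (z0 + s *s v)) \<le> M / \<rho>"
      by (rule uniform_dir_derivative[OF h' \<rho>(1) M order_eq_refl[OF norm_axis_1, of j] v,
            unfolded sum_cpartial_axis]) blast+
    obtain d where d: "((\<lambda>s. cpartial j h (z0 + s *s v)) has_field_derivative d) (at 0)"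
      "((\<lambda>s. \<Sum>i\<in>UNIV. cpartial i h (z0 + s *s axis j 1) * v $ i) has_field_derivative d) (at 0)"
      using dir_derivative_commute[OF h' \<rho>(1) M, of "axis j 1" v, unfolded sum_cpartial_axis] v
      by auto
    have "((\<lambda>s. \<Sum>i\<in>UNIV. cpartial i h (z0 + s *s axis j 1) * v $ i) has_field_derivative
        (\<Sum>i\<in>UNIV. c $ i * v $ i)) (at 0)"
      by (intro DERIV_sum DERIV_cmult_right c)
    with d(2) have "d = (\<Sum>i\<in>UNIV. c $ i * v $ i)" by (rule DERIV_unique)
    with d(1) have "deriv (\<lambda>s. cpartial j h (z0 + s *s v)) 0 = (\<Sum>i\<in>UNIV. c $ i * v $ i)"
      by (simp add: DERIV_imp_deriv)
    moreover have "(\<lambda>s. cpartial j h (z0 + s *s v)) holomorphic_on ball 0 \<rho>"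
      unfolding holomorphic_on_open[OF open_ball]
      by (rule ballI, rule exI, rule g(1)) simp
    ultimately show ?thesis
      using holomorphic_linear_approx[of "\<lambda>s. cpartial j h (z0 + s *s v)" \<rho> "M / \<rho>" s] g(2) \<rho>(1) s
      by (simp add: K_def)
  qed
  have "(cpartial j h has_derivative (\<lambda>v. \<Sum>i\<in>UNIV. c $ i * v $ i)) (at z0)"
  proof (rule has_derivativeI_sandwich[where e = "\<rho> / 2" and H = "\<lambda>y. K * norm (y - z0)"])
    show "bounded_linear (\<lambda>v. \<Sum>i\<in>UNIV. c $ i * v $ i)"
      by (intro bounded_linear_sum bounded_linear_mult_right[THEN bounded_linear_compose]
          bounded_linear_vec_nth)
    have "((\<lambda>y. K * norm (y - z0)) \<longlongrightarrow> K * norm (z0 - z0)) (at z0)"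
      by (intro tendsto_intros)
    then show "((\<lambda>y. K * norm (y - z0)) \<longlongrightarrow> 0) (at z0)" by simp
    fix y assume y: "y \<noteq> z0" "dist y z0 < \<rho> / 2"
    define s where "s = norm (y - z0)"
    define v where "v = complex_of_real (1 / s) *s (y - z0)"
    have s: "s > 0" "s \<le> \<rho> / 2" using y by (auto simp: s_def dist_norm)
    have "norm v \<le> 1" unfolding v_def norm_cvec_scale using s by (simp add: norm_divide flip: s_def)
    moreover have sv: "of_real s *s v = y - z0" using s by (simp add: v_def vector_smult_assoc)
    moreover have "of_real s * (\<Sum>i\<in>UNIV. c $ i * v $ i) = (\<Sum>i\<in>UNIV. c $ i * (y - z0) $ i)"
      unfolding sv[symmetric] by (simp add: sum_distrib_left mult_ac)
    ultimately have "cmod (cpartial j h y - cpartial j h z0 - (\<Sum>i\<in>UNIV. c $ i * (y - z0) $ i))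
        \<le> K * s\<^sup>2"
      using approx[of v "of_real s"] s by simp
    then show "norm (cpartial j h y - cpartial j h z0 - (\<Sum>i\<in>UNIV. c $ i * (y - z0) $ i))
        / norm (y - z0) \<le> K * norm (y - z0)"
      using s by (simp add: divide_simps power2_eq_square mult_ac flip: s_def)
  qed (use \<rho> in auto)
  then show "\<exists>c. (cpartial j h has_derivative (\<lambda>v. \<Sum>i\<in>UNIV. c $ i * v $ i)) (at z0)" by blast
qed

section \<open>Matrix inverses and the derivative of a determinant\<close>

lemma matrix_inv_right_left:
  fixes A :: "complex ^ 'n ^ 'n"
  assumes "det A \<noteq> 0"
  shows "A ** matrix_inv A = mat 1" "matrix_inv A ** A = mat 1"
proof -
  have "\<exists>B. A ** B = mat 1 \<and> B ** A = mat 1"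
    using assms by (simp add: invertible_det_nz[symmetric] invertible_def)
  then have "A ** matrix_inv A = mat 1 \<and> matrix_inv A ** A = mat 1"
    unfolding matrix_inv_def by (rule someI_ex)
  then show "A ** matrix_inv A = mat 1" "matrix_inv A ** A = mat 1" by auto
qed

text \<open>Cramer's rule for column \<open>l\<close> of the inverse. It presents each entry as a
  quotient of polynomials in the entries of \<open>A\<close>, so holomorphy passes to the
  inverse.\<close>

lemma matrix_inv_cramer:
  fixes A :: "complex ^ 'n ^ 'n"
  assumes "det A \<noteq> 0"
  shows "matrix_inv A $ k $ l =
    det (\<chi> i j. if j = k then (if i = l then 1 else 0) else A $ i $ j) / det A"
proof -
  define x where "x = column l (matrix_inv A)"
  have "A *v x = (\<chi> i. (A ** matrix_inv A) $ i $ l)"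
    by (simp add: x_def matrix_vector_mult_def matrix_matrix_mult_def column_def vec_eq_iff)
  also have "\<dots> = (\<chi> i. if i = l then 1 else 0)"
    by (simp add: matrix_inv_right_left[OF assms] mat_def)
  finally have "x = (\<chi> k. det (\<chi> i j. if j = k then (\<chi> i. if i = l then 1 else 0) $ i else A $ i $ j) / det A)"
    using cramer[OF assms] by blast
  then have "x $ k = det (\<chi> i j. if j = k then (if i = l then 1 else 0) else A $ i $ j) / det A"
    by (metis (no_types, lifting) Cart_lambda_cong vec_lambda_beta)
  then show ?thesis by (simp add: x_def column_def)
qed

lemma cdiff_on_det:
  fixes A :: "complex ^ 'm \<Rightarrow> complex ^ 'n ^ 'n"
  assumes "\<And>i j. cdiff_on (\<lambda>z. A z $ i $ j) U"
  shows "cdiff_on (\<lambda>z. det (A z)) U"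
  unfolding det_def by (intro cdiff_on_intros assms)

lemma cdiff_on_matrix_inv:
  fixes A :: "complex ^ 'm \<Rightarrow> complex ^ 'n ^ 'n"
  assumes "\<And>i j. cdiff_on (\<lambda>z. A z $ i $ j) U" "\<And>z. z \<in> U \<Longrightarrow> det (A z) \<noteq> 0" "open U"
  shows "cdiff_on (\<lambda>z. matrix_inv (A z) $ k $ l) U"
proof (rule cdiff_on_cong[OF assms(3)])
  show "cdiff_on (\<lambda>z. det (\<chi> i j. if j = k then (if i = l then 1 else 0) else A z $ i $ j) / det (A z)) U"
  proof (intro cdiff_on_divide cdiff_on_det assms)
    fix i j
    show "cdiff_on (\<lambda>z. (\<chi> i j. if j = k then (if i = l then 1 else 0) else A z $ i $ j) $ i $ j) U"
      by (cases "j = k") (simp_all add: cdiff_on_const assms)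
  qed
qed (simp add: matrix_inv_cramer assms)

text \<open>Row \<open>i\<close> of the product combines the rows of \<open>A\<close> with
  coefficients \<open>B $ i\<close>; by alternation only the multiple of row \<open>i\<close> itself
  contributes.\<close>

lemma det_replace_row:
  fixes A B :: "complex ^ 'n ^ 'n"
  shows "det (\<chi> r. if r = i then row i (B ** A) else row r A) = B $ i $ i * det A"
proof -
  have "row i (B ** A) = (\<Sum>k\<in>UNIV. (B $ i) $ k *s row k A)"
    by (simp add: row_def matrix_matrix_mult_def vec_eq_iff)
  then show ?thesis
    using cramer_lemma_transpose[of i "B $ i" A] by presburger
qed

text \<open>Jacobi's formula. The product rule in the Leibniz expansion differentiates one row at a
  time; writing the derivative matrix as \<open>B ** A z\<close> turns each summand into
  \<open>B $ i $ i * det (A z)\<close>.\<close>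

lemma cpartial_det:
  fixes A :: "complex ^ 'n \<Rightarrow> complex ^ 'n ^ 'n"
  assumes A: "\<And>i j. cdiff_on (\<lambda>z. A z $ i $ j) U" and z: "z \<in> U" "det (A z) \<noteq> 0"
  shows "cpartial m (\<lambda>z. det (A z)) z =
    det (A z) * (\<Sum>i\<in>UNIV. \<Sum>l\<in>UNIV. cpartial m (\<lambda>z. A z $ i $ l) z * matrix_inv (A z) $ l $ i)"
proof -
  define A' where "A' = (\<chi> i j. cpartial m (\<lambda>z. A z $ i $ j) z)"
  define B where "B = A' ** matrix_inv (A z)"
  have "B ** A z = A'"
    by (simp add: B_def matrix_mul_assoc[symmetric] matrix_inv_right_left[OF z(2)])
  note rep = det_replace_row[of _ B "A z", unfolded this]
  have "cpartial m (\<lambda>z. det (A z)) z = (\<Sum>p | p permutes (UNIV :: 'n set). of_int (sign p) *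
      (\<Sum>i\<in>UNIV. A' $ i $ p i * (\<Prod>r\<in>UNIV - {i}. A z $ r $ p r)))"
    unfolding det_def
  proof (rule cpartial_unique, intro DERIV_sum DERIV_cmult)
    fix p :: "'n \<Rightarrow> 'n"
    have *: "((\<lambda>t. A (z + t *s axis m 1) $ i $ p i) has_field_derivative A' $ i $ p i) (at 0)" for i
      using cdiff_on_axis[OF A z(1)] by (simp add: A'_def)
    show "((\<lambda>t. \<Prod>i\<in>UNIV. A (z + t *s axis m 1) $ i $ p i) has_field_derivative
        (\<Sum>i\<in>UNIV. A' $ i $ p i * (\<Prod>r\<in>UNIV - {i}. A z $ r $ p r))) (at 0)"
      using has_field_derivative_prod[of UNIV "\<lambda>i t. A (z + t *s axis m 1) $ i $ p i", OF *] by simp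
  qed
  also have "\<dots> = (\<Sum>i\<in>UNIV. \<Sum>p | p permutes (UNIV :: 'n set). of_int (sign p) *
      (A' $ i $ p i * (\<Prod>r\<in>UNIV - {i}. A z $ r $ p r)))"
    unfolding sum_distrib_left by (rule sum.swap)
  also have "\<dots> = (\<Sum>i\<in>UNIV. det (\<chi> r. if r = i then row i A' else row r (A z)))"
  proof (intro sum.cong refl)
    fix i :: 'n
    show "(\<Sum>p | p permutes (UNIV :: 'n set). of_int (sign p) *
        (A' $ i $ p i * (\<Prod>r\<in>UNIV - {i}. A z $ r $ p r))) =
        det (\<chi> r. if r = i then row i A' else row r (A z))"
      unfolding det_def
    proof (intro sum.cong refl arg_cong2[where f = "(*)"])
      fix p :: "'n \<Rightarrow> 'n"
      show "A' $ i $ p i * (\<Prod>r\<in>UNIV - {i}. A z $ r $ p r) =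
        (\<Prod>r\<in>UNIV. (\<chi> r. if r = i then row i A' else row r (A z)) $ r $ p r)"
        by (subst prod.remove[of UNIV i]) (auto simp: row_def intro!: prod.cong)
    qed
  qed
  also have "\<dots> = det (A z) * (\<Sum>i\<in>UNIV. B $ i $ i)"
    by (simp add: rep sum_distrib_left mult.commute)
  finally show ?thesis
    by (simp add: B_def matrix_matrix_mult_def A'_def)
qed

section \<open>Jacobians of locally biholomorphic mappings\<close>

lemma holomorphic_map_on_component:
  fixes f :: "complex ^ 'n \<Rightarrow> complex ^ 'm"
  assumes "holomorphic_map_on f U"
  shows "cdiff_on (\<lambda>z. f z $ l) U"
  unfolding cdiff_on_def
proof
  fix z assume "z \<in> U"
  then obtain A where "(f has_derivative (\<lambda>v. A *v v)) (at z)"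
    using assms unfolding holomorphic_map_on_def by blast
  then have "((\<lambda>z. f z $ l) has_derivative (\<lambda>v. (A *v v) $ l)) (at z)"
    by (rule bounded_linear.has_derivative[OF bounded_linear_vec_nth])
  then show "\<exists>c. ((\<lambda>z. f z $ l) has_derivative (\<lambda>v. \<Sum>i\<in>UNIV. c $ i * v $ i)) (at z)"
    by (auto simp: matrix_vector_mult_def)
qed

lemma cjacobian_eqI:
  fixes f :: "complex ^ 'n \<Rightarrow> complex ^ 'n"
  assumes "(f has_derivative (\<lambda>v. A *v v)) (at z)"
  shows "cjacobian f z = A"
proof -
  have "((\<lambda>z. f z $ l) has_derivative (\<lambda>v. \<Sum>i\<in>UNIV. A $ l $ i * v $ i)) (at z)" for l
    using bounded_linear.has_derivative[OF bounded_linear_vec_nth assms, of l]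
    by (simp add: matrix_vector_mult_def)
  then have "cpartial i (\<lambda>z. f z $ l) z = A $ l $ i" for l i
    by (rule cpartial_eqI)
  then show ?thesis by (simp add: cjacobian_def vec_eq_iff)
qed

lemma locally_biholomorphic_on_imp_cdiff:
  fixes f :: "complex ^ 'n \<Rightarrow> complex ^ 'n"
  assumes "locally_biholomorphic_on f U"
  shows "cdiff_on (\<lambda>z. f z $ l) U"
  unfolding cdiff_on_def
proof
  fix z assume "z \<in> U"
  then obtain V where "z \<in> V" "holomorphic_map_on f V"
    using assms unfolding locally_biholomorphic_on_def by blast
  then show "\<exists>c. ((\<lambda>z. f z $ l) has_derivative (\<lambda>v. \<Sum>i\<in>UNIV. c $ i * v $ i)) (at z)"
    using holomorphic_map_on_component unfolding cdiff_on_def by blast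
qed

text \<open>The chain rule for the local inverse after \<open>f\<close> yields a left inverse of the
  Jacobian matrix.\<close>

lemma locally_biholomorphic_on_jac_nonzero:
  fixes f :: "complex ^ 'n \<Rightarrow> complex ^ 'n"
  assumes "locally_biholomorphic_on f U" "z \<in> U"
  shows "jac_det f z \<noteq> 0"
proof -
  obtain V where V: "open V" "z \<in> V" "inj_on f V" "holomorphic_map_on f V"
    "holomorphic_map_on (inv_into V f) (f ` V)"
    using assms unfolding locally_biholomorphic_on_def by blast
  obtain A where A: "(f has_derivative (\<lambda>v. A *v v)) (at z)"
    using V unfolding holomorphic_map_on_def by blast
  obtain B where B: "(inv_into V f has_derivative (\<lambda>v. B *v v)) (at (f z))"
    using V unfolding holomorphic_map_on_def by blast
  have "((\<lambda>w. inv_into V f (f w)) has_derivative (\<lambda>v. B *v (A *v v))) (at z)"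
    by (rule has_derivative_compose[OF A B])
  then have "((\<lambda>w. w) has_derivative (\<lambda>v. B *v (A *v v))) (at z)"
    by (rule has_derivative_transform_within_open[OF _ V(1,2)]) (simp add: V(3))
  then have "(\<lambda>v. B *v (A *v v)) = (\<lambda>v. v)"
    using has_derivative_unique has_derivative_ident by blast
  then have "(B ** A) *v v = mat 1 *v v" for v
    by (simp add: matrix_vector_mul_assoc[symmetric] fun_eq_iff)
  then have "B ** A = mat 1" unfolding matrix_eq by blast
  then have "invertible A" by (metis invertible_left_inverse)
  then show ?thesis
    by (simp add: jac_det_def cjacobian_eqI[OF A] invertible_det_nz)
qed

section \<open>The connection defined by the Schwarzian derivatives\<close>

lemma sum_sum_delta1:
  fixes a :: "'n::finite \<Rightarrow> complex" and b :: "'n \<Rightarrow> 'n \<Rightarrow> complex"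
  shows "(\<Sum>p\<in>UNIV. \<Sum>k\<in>UNIV. (if p = i then a k else 0) * b k p) = (\<Sum>k\<in>UNIV. a k * b k i)"
  by (subst sum.swap) (simp add: if_distrib[of "\<lambda>x. x * _"] cong: if_cong)

text \<open>Index algebra at one point, with \<open>dG m\<close>, \<open>dS m\<close> and
  \<open>d\<psi> m\<close> standing for derivatives in direction \<open>m\<close>. Putting
  \<open>m = p\<close> in \<open>flat\<close> and summing over \<open>p\<close> leaves
  \<open>2 * d\<psi> i j\<close> on the left against \<open>(N + 1) * d\<psi> i j\<close> on the
  right, whence the factor \<open>N - 1\<close>.\<close>

lemma traced_flatness:
  fixes G S :: "'n::finite \<Rightarrow> 'n \<Rightarrow> 'n \<Rightarrow> complex" and \<psi> :: "'n \<Rightarrow> complex"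
    and dG dS :: "'n \<Rightarrow> 'n \<Rightarrow> 'n \<Rightarrow> 'n \<Rightarrow> complex" and d\<psi> :: "'n \<Rightarrow> 'n \<Rightarrow> complex"
  defines "N \<equiv> of_nat CARD('n) :: complex"
  assumes G: "\<And>p i j. G p i j = S p i j + ((if p = i then \<psi> j else 0) + (if p = j then \<psi> i else 0))"
    and dG: "\<And>m p i j. dG m p i j =
      dS m p i j + ((if p = i then d\<psi> m j else 0) + (if p = j then d\<psi> m i else 0))"
    and flat: "\<And>p m i j. dG m p i j + (\<Sum>k\<in>UNIV. G p m k * G k i j) =
      dG i p m j + (\<Sum>k\<in>UNIV. G p i k * G k m j)"
    and sym: "\<And>p i j. G p i j = G p j i" "\<And>m p i j. dG m p i j = dG m p j i"
    and tr: "\<And>j. (\<Sum>p\<in>UNIV. G p p j) = (N + 1) * \<psi> j"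
    and dtr: "\<And>i j. (\<Sum>p\<in>UNIV. dG i p p j) = (N + 1) * d\<psi> i j"
  shows "(N - 1) * d\<psi> i j = (N - 1) * ((\<Sum>k\<in>UNIV. \<psi> k * S k i j) + \<psi> i * \<psi> j) +
    ((\<Sum>k\<in>UNIV. dS k k i j) - (\<Sum>p\<in>UNIV. \<Sum>k\<in>UNIV. S p i k * S k p j))"
proof -
  have "N + 1 \<noteq> 0"
    unfolding N_def by (metis of_nat_Suc add.commute of_nat_eq_0_iff nat.distinct(1))
  \<comment> \<open>Contracting the upper index with the last lower one instead shows that
    \<open>\<psi>\<close> is closed: the quadratic terms agree after exchanging the summation
    indices.\<close>
  have d\<psi>sym: "d\<psi> i j = d\<psi> j i" for i j
  proof -
    have eq: "dG i p p j + (\<Sum>k\<in>UNIV. G p i k * G k j p) =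
        dG j p p i + (\<Sum>k\<in>UNIV. G p j k * G k i p)" for p
      using flat[of i p j p] sym(2)[of i p j p] sym(2)[of j p i p] by argo
    have "(\<Sum>p\<in>UNIV. dG i p p j) + (\<Sum>p\<in>UNIV. \<Sum>k\<in>UNIV. G p i k * G k j p) =
        (\<Sum>p\<in>UNIV. dG j p p i) + (\<Sum>p\<in>UNIV. \<Sum>k\<in>UNIV. G p j k * G k i p)"
      unfolding sum.distrib[symmetric] by (intro sum.cong refl eq)
    moreover have "(\<Sum>p\<in>UNIV. \<Sum>k\<in>UNIV. G p i k * G k j p) = (\<Sum>p\<in>UNIV. \<Sum>k\<in>UNIV. G p j k * G k i p)"
      by (subst sum.swap) (simp add: mult.commute)
    ultimately show ?thesis using \<open>N + 1 \<noteq> 0\<close> by (simp add: dtr)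
  qed
  have Ssym: "S p i j = S p j i" for p i j
    using sym(1)[of p i j] unfolding G by (auto split: if_splits)
  have Str: "(\<Sum>p\<in>UNIV. S p p j) = 0" for j
    using tr[of j] by (simp add: G sum.distrib N_def algebra_simps)
  have Str': "(\<Sum>p\<in>UNIV. S p i p) = 0" for i
    using Str[of i] unfolding Ssym[of _ _ i] .
  have dGt: "(\<Sum>p\<in>UNIV. dG p p i j) = (\<Sum>k\<in>UNIV. dS k k i j) + 2 * d\<psi> i j"
    unfolding dG sum.distrib by (simp add: d\<psi>sym[of j i])
  have "(\<Sum>k\<in>UNIV. \<psi> k * G k i j) = (\<Sum>k\<in>UNIV. \<psi> k * S k i j) + 2 * \<psi> i * \<psi> j"
    by (simp add: G distrib_left sum.distrib if_distrib[of "\<lambda>x. _ * x"] cong: if_cong)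
  moreover have "(\<Sum>p\<in>UNIV. \<Sum>k\<in>UNIV. G p p k * G k i j) = (N + 1) * (\<Sum>k\<in>UNIV. \<psi> k * G k i j)"
    by (subst sum.swap) (simp add: sum_distrib_right[symmetric] tr sum_distrib_left mult.assoc)
  ultimately have GG1: "(\<Sum>p\<in>UNIV. \<Sum>k\<in>UNIV. G p p k * G k i j) =
      (N + 1) * ((\<Sum>k\<in>UNIV. \<psi> k * S k i j) + 2 * \<psi> i * \<psi> j)" by simp
  \<comment> \<open>The Kronecker terms of \<open>G p i k\<close> are \<open>?a\<close> and
    \<open>?b\<close>, those of \<open>G k p j\<close> are \<open>?c\<close> and \<open>?d\<close>.
    Of the nine products, the two containing a trace of \<open>S\<close> vanish, and the four
    without \<open>S\<close> add up to the coefficient \<open>N + 3\<close>.\<close>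
  let ?a = "\<lambda>p k. if p = i then \<psi> k else 0" and ?b = "\<lambda>p k :: 'n. if p = k then \<psi> i else 0"
  let ?c = "\<lambda>p k :: 'n. if k = p then \<psi> j else 0" and ?d = "\<lambda>p k. if k = j then \<psi> p else 0"
  have "(\<Sum>p\<in>UNIV. \<Sum>k\<in>UNIV. G p i k * G k p j) =
      (\<Sum>p\<in>UNIV. \<Sum>k\<in>UNIV. S p i k * S k p j)
    + (\<Sum>p\<in>UNIV. \<Sum>k\<in>UNIV. ?a p k * S k p j)
    + (\<Sum>p\<in>UNIV. \<Sum>k\<in>UNIV. ?b p k * S k p j)
    + (\<Sum>p\<in>UNIV. \<Sum>k\<in>UNIV. S p i k * ?c p k)
    + (\<Sum>p\<in>UNIV. \<Sum>k\<in>UNIV. ?a p k * ?c p k)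
    + (\<Sum>p\<in>UNIV. \<Sum>k\<in>UNIV. ?b p k * ?c p k)
    + (\<Sum>p\<in>UNIV. \<Sum>k\<in>UNIV. S p i k * ?d p k)
    + (\<Sum>p\<in>UNIV. \<Sum>k\<in>UNIV. ?a p k * ?d p k)
    + (\<Sum>p\<in>UNIV. \<Sum>k\<in>UNIV. ?b p k * ?d p k)"
    unfolding G distrib_left distrib_right sum.distrib by (simp only: add.assoc)
  moreover have "(\<Sum>p\<in>UNIV. \<Sum>k\<in>UNIV. S p i k * ?c p k) = 0"
    by (simp add: if_distrib[of "\<lambda>x. _ * x"] Str' sum_distrib_right[symmetric] cong: if_cong)
  moreover have "(\<Sum>p\<in>UNIV. \<Sum>k\<in>UNIV. S p i k * ?d p k) = (\<Sum>k\<in>UNIV. \<psi> k * S k i j)"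
    by (simp add: if_distrib[of "\<lambda>x. _ * x"] mult.commute cong: if_cong)
  moreover have "(\<Sum>p\<in>UNIV. \<Sum>k\<in>UNIV. ?a p k * S k p j) = (\<Sum>k\<in>UNIV. \<psi> k * S k i j)"
    by (rule sum_sum_delta1)
  moreover have "(\<Sum>p\<in>UNIV. \<Sum>k\<in>UNIV. ?a p k * ?c p k) = \<psi> i * \<psi> j"
    unfolding sum_sum_delta1[of i \<psi> "\<lambda>k p. ?c p k"]
    by (simp add: if_distrib[of "\<lambda>x. _ * x"] cong: if_cong)
  moreover have "(\<Sum>p\<in>UNIV. \<Sum>k\<in>UNIV. ?a p k * ?d p k) = \<psi> i * \<psi> j"
    unfolding sum_sum_delta1[of i \<psi> "\<lambda>k p. ?d p k"]
    by (simp add: if_distrib[of "\<lambda>x. _ * x"] mult.commute cong: if_cong)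
  moreover have "(\<Sum>p\<in>UNIV. \<Sum>k\<in>UNIV. ?b p k * S k p j) = 0"
    by (simp add: if_distrib[of "\<lambda>x. x * _"] Str sum_distrib_left[symmetric] cong: if_cong)
  moreover have "(\<Sum>p\<in>UNIV. \<Sum>k\<in>UNIV. ?b p k * ?c p k) = N * \<psi> i * \<psi> j"
    by (simp add: if_distrib[of "\<lambda>x. x * _"] N_def cong: if_cong)
  moreover have "(\<Sum>p\<in>UNIV. \<Sum>k\<in>UNIV. ?b p k * ?d p k) = \<psi> i * \<psi> j"
    by (simp add: if_distrib[of "\<lambda>x. x * _"] if_distrib[of "\<lambda>x. _ * x"] cong: if_cong)
  ultimately have GG2: "(\<Sum>p\<in>UNIV. \<Sum>k\<in>UNIV. G p i k * G k p j) =
      (\<Sum>p\<in>UNIV. \<Sum>k\<in>UNIV. S p i k * S k p j) + 2 * (\<Sum>k\<in>UNIV. \<psi> k * S k i j)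
      + (N + 3) * (\<psi> i * \<psi> j)"
    by (simp add: algebra_simps)
  have "(\<Sum>p\<in>UNIV. dG p p i j) + (\<Sum>p\<in>UNIV. \<Sum>k\<in>UNIV. G p p k * G k i j) =
      (\<Sum>p\<in>UNIV. dG i p p j) + (\<Sum>p\<in>UNIV. \<Sum>k\<in>UNIV. G p i k * G k p j)"
    unfolding sum.distrib[symmetric] by (intro sum.cong refl flat)
  then show ?thesis
    unfolding dGt GG1 GG2 dtr by (simp add: algebra_simps)
qed

section \<open>Connection coefficients of a locally biholomorphic mapping\<close>

locale locally_biholomorphic =
  fixes f :: "complex ^ 'n \<Rightarrow> complex ^ 'n" and U :: "(complex ^ 'n) set"
  assumes open_U: "open U" and biholo: "locally_biholomorphic_on f U"
begin

abbreviation "D1 i l \<equiv> cpartial i (\<lambda>w. f w $ l)"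
abbreviation "D2 i j l \<equiv> cpartial i (cpartial j (\<lambda>w. f w $ l))"

definition "\<Gamma> k i j z = (\<Sum>l\<in>UNIV. D2 i j l z * matrix_inv (cjacobian f z) $ k $ l)"

definition "\<psi> j z = log_cpartial j (jac_det f) z / of_nat (CARD('n) + 1)"

text \<open>The Ricci tensor of the trace-free connection with coefficients
  \<open>schwarzian_deriv k i j f\<close>, divided by n - 1.\<close>

definition "Q i j z = ((\<Sum>k\<in>UNIV. cpartial k (schwarzian_deriv k i j f) z) -
  (\<Sum>p\<in>UNIV. \<Sum>k\<in>UNIV. schwarzian_deriv p i k f z * schwarzian_deriv k p j f z)) /
  (of_nat CARD('n) - 1)"

lemma cdiff_f: "cdiff_on (\<lambda>z. f z $ l) U"
  by (rule locally_biholomorphic_on_imp_cdiff[OF biholo])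

lemma cdiff_D1: "cdiff_on (D1 i l) U"
  by (rule cdiff_on_cpartial[OF cdiff_f open_U])

lemma cdiff_D2: "cdiff_on (D2 i j l) U"
  by (rule cdiff_on_cpartial[OF cdiff_D1 open_U])

lemma cdiff_cjacobian: "cdiff_on (\<lambda>z. cjacobian f z $ i $ j) U"
  by (simp add: cjacobian_def cdiff_D1)

lemma det_cjacobian: "z \<in> U \<Longrightarrow> det (cjacobian f z) \<noteq> 0"
  using locally_biholomorphic_on_jac_nonzero[OF biholo] by (simp add: jac_det_def)

lemma cdiff_\<Gamma>: "cdiff_on (\<Gamma> k i j) U"
  unfolding \<Gamma>_def[abs_def]
  by (intro cdiff_on_intros cdiff_D2 cdiff_on_matrix_inv cdiff_cjacobian det_cjacobian open_U)

lemma cdiff_jac_det: "cdiff_on (jac_det f) U"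
  unfolding jac_det_def[abs_def] by (intro cdiff_on_det cdiff_cjacobian)

lemma cdiff_\<psi>: "cdiff_on (\<psi> j) U"
  unfolding \<psi>_def[abs_def] log_cpartial_def
  by (intro cdiff_on_divide cdiff_on_const cdiff_on_cpartial cdiff_jac_det open_U)
     (auto simp: jac_det_def det_cjacobian simp del: of_nat_add of_nat_Suc)

lemma schwarzian_deriv_eq:
  "schwarzian_deriv k i j f z =
    \<Gamma> k i j z - ((if k = i then \<psi> j z else 0) + (if k = j then \<psi> i z else 0))"
  by (simp add: schwarzian_deriv_def \<Gamma>_def \<psi>_def add_divide_distrib)

lemma cdiff_schwarzian: "cdiff_on (schwarzian_deriv k i j f) U"
  unfolding schwarzian_deriv_eq[abs_def]
  by (cases "k = i"; cases "k = j") (simp_all add: cdiff_on_intros cdiff_\<Gamma> cdiff_\<psi>)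

lemma \<Gamma>_sym: "z \<in> U \<Longrightarrow> \<Gamma> k i j z = \<Gamma> k j i z"
  unfolding \<Gamma>_def by (simp add: cpartial_commute[OF cdiff_f open_U, of z i j])

lemma jacobian_inverse:
  assumes "z \<in> U"
  shows "(\<Sum>k\<in>UNIV. D1 k l z * matrix_inv (cjacobian f z) $ k $ m) = (if l = m then 1 else 0)"
    and "(\<Sum>l\<in>UNIV. matrix_inv (cjacobian f z) $ k $ l * D1 i l z) = (if k = i then 1 else 0)"
  using matrix_inv_right_left[OF det_cjacobian[OF assms]]
  by (simp_all add: matrix_matrix_mult_def mat_def cjacobian_def vec_eq_iff)

text \<open>The components of \<open>f\<close> are flat coordinates, so their covariant Hessians
  vanish; computationally, the Jacobian cancels the inverse inside \<open>\<Gamma>\<close>.\<close>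

lemma D2_eq:
  assumes "z \<in> U"
  shows "D2 i j l z = (\<Sum>k\<in>UNIV. D1 k l z * \<Gamma> k i j z)"
proof -
  have "(\<Sum>k\<in>UNIV. D1 k l z * \<Gamma> k i j z) =
      (\<Sum>k\<in>UNIV. \<Sum>m\<in>UNIV. D2 i j m z * (D1 k l z * matrix_inv (cjacobian f z) $ k $ m))"
    by (simp add: \<Gamma>_def sum_distrib_left mult_ac)
  also have "\<dots> = (\<Sum>m\<in>UNIV. D2 i j m z * (\<Sum>k\<in>UNIV. D1 k l z * matrix_inv (cjacobian f z) $ k $ m))"
    by (subst sum.swap) (simp add: sum_distrib_left)
  also have "\<dots> = D2 i j l z"
    by (simp add: jacobian_inverse[OF assms] if_distrib[of "\<lambda>x. _ * x"] cong: if_cong)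
  finally show ?thesis by simp
qed

lemma jacobian_cancel:
  assumes z: "z \<in> U"
    and eq: "\<And>l. (\<Sum>p\<in>UNIV. D1 p l z * X p) = (\<Sum>p\<in>UNIV. D1 p l z * Y p)"
  shows "X p = Y p"
proof -
  have "(\<Sum>l\<in>UNIV. matrix_inv (cjacobian f z) $ p $ l * (\<Sum>q\<in>UNIV. D1 q l z * X q)) = X p" for X
  proof -
    have "(\<Sum>l\<in>UNIV. matrix_inv (cjacobian f z) $ p $ l * (\<Sum>q\<in>UNIV. D1 q l z * X q)) =
        (\<Sum>q\<in>UNIV. (\<Sum>l\<in>UNIV. matrix_inv (cjacobian f z) $ p $ l * D1 q l z) * X q)"
      unfolding sum_distrib_left sum_distrib_right by (subst sum.swap) (simp add: mult_ac)
    also have "\<dots> = X p"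
      by (simp add: jacobian_inverse[OF z] if_distrib[of "\<lambda>x. x * _"] cong: if_cong)
    finally show ?thesis .
  qed
  from this[of X] this[of Y] show ?thesis by (simp add: eq)
qed

text \<open>Third derivatives of \<open>f\<close> commute. Differentiating \<open>D2_eq\<close>
  expresses both orders through \<open>\<Gamma>\<close>, and the invertible Jacobian can then be
  cancelled.\<close>

lemma \<Gamma>_flat:
  assumes z: "z \<in> U"
  shows "cpartial m (\<Gamma> p i j) z + (\<Sum>k\<in>UNIV. \<Gamma> p m k z * \<Gamma> k i j z) =
    cpartial i (\<Gamma> p m j) z + (\<Sum>k\<in>UNIV. \<Gamma> p i k z * \<Gamma> k m j z)"
proof (rule jacobian_cancel[OF z, of
      "\<lambda>p. cpartial m (\<Gamma> p i j) z + (\<Sum>k\<in>UNIV. \<Gamma> p m k z * \<Gamma> k i j z)"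
      "\<lambda>p. cpartial i (\<Gamma> p m j) z + (\<Sum>k\<in>UNIV. \<Gamma> p i k z * \<Gamma> k m j z)"])
  fix l
  have "cpartial m (D2 i j l) z = (\<Sum>p\<in>UNIV. D1 p l z *
      (cpartial m (\<Gamma> p i j) z + (\<Sum>k\<in>UNIV. \<Gamma> p m k z * \<Gamma> k i j z)))" for m i
  proof -
    have "cpartial m (D2 i j l) z = cpartial m (\<lambda>z. \<Sum>k\<in>UNIV. D1 k l z * \<Gamma> k i j z) z"
      by (rule cpartial_cong[OF open_U z D2_eq])
    also have "\<dots> = (\<Sum>k\<in>UNIV. cpartial m (\<lambda>z. D1 k l z * \<Gamma> k i j z) z)"
      by (rule cpartial_sum[OF _ z]) (intro cdiff_on_mult cdiff_D1 cdiff_\<Gamma>)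
    also have "\<dots> = (\<Sum>k\<in>UNIV. D2 m k l z * \<Gamma> k i j z) +
        (\<Sum>k\<in>UNIV. D1 k l z * cpartial m (\<Gamma> k i j) z)"
      by (simp add: cpartial_mult[OF cdiff_D1 cdiff_\<Gamma> z] sum.distrib)
    also have "(\<Sum>k\<in>UNIV. D2 m k l z * \<Gamma> k i j z) =
        (\<Sum>p\<in>UNIV. D1 p l z * (\<Sum>k\<in>UNIV. \<Gamma> p m k z * \<Gamma> k i j z))"
      unfolding D2_eq[OF z] sum_distrib_left sum_distrib_right
      by (subst sum.swap) (simp add: mult_ac)
    finally show ?thesis by (simp add: distrib_left sum.distrib add.commute)
  qed
  from this[of m i] this[of i m] cpartial_commute[OF cdiff_D1 open_U z, of m i j l]
  show "(\<Sum>p\<in>UNIV. D1 p l z *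
      (cpartial m (\<Gamma> p i j) z + (\<Sum>k\<in>UNIV. \<Gamma> p m k z * \<Gamma> k i j z))) =
    (\<Sum>p\<in>UNIV. D1 p l z *
      (cpartial i (\<Gamma> p m j) z + (\<Sum>k\<in>UNIV. \<Gamma> p i k z * \<Gamma> k m j z)))"
    by simp
qed

text \<open>The trace is the logarithmic derivative of the Jacobian determinant, by Jacobi's
  formula. This is why the Schwarzian derivatives are trace-free.\<close>

lemma \<Gamma>_trace:
  assumes z: "z \<in> U"
  shows "(\<Sum>k\<in>UNIV. \<Gamma> k k j z) = (of_nat CARD('n) + 1) * \<psi> j z"
proof -
  have "cpartial j (jac_det f) z = jac_det f z *
      (\<Sum>i\<in>UNIV. \<Sum>l\<in>UNIV. D2 j l i z * matrix_inv (cjacobian f z) $ l $ i)"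
    using cpartial_det[of "cjacobian f", OF cdiff_cjacobian z det_cjacobian[OF z], of j]
    unfolding jac_det_def[abs_def] by (simp only: cjacobian_def vec_lambda_beta)
  also have "(\<Sum>i\<in>UNIV. \<Sum>l\<in>UNIV. D2 j l i z * matrix_inv (cjacobian f z) $ l $ i) =
      (\<Sum>k\<in>UNIV. \<Gamma> k j k z)"
    unfolding \<Gamma>_def by (rule sum.swap)
  finally have "cpartial j (jac_det f) z / jac_det f z = (\<Sum>k\<in>UNIV. \<Gamma> k k j z)"
    using locally_biholomorphic_on_jac_nonzero[OF biholo z]
    by (simp add: \<Gamma>_sym[OF z, of _ j])
  moreover have "of_nat CARD('n) + 1 \<noteq> (0 :: complex)"
    by (metis of_nat_Suc add.commute of_nat_eq_0_iff nat.distinct(1))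
  ultimately show ?thesis
    by (simp add: \<psi>_def log_cpartial_def field_simps)
qed

lemma cpartial_\<psi>:
  assumes z: "z \<in> U" and n: "CARD('n) \<ge> 2"
  shows "cpartial i (\<psi> j) z =
    (\<Sum>k\<in>UNIV. \<psi> k z * schwarzian_deriv k i j f z) + \<psi> i z * \<psi> j z + Q i j z"
proof -
  let ?N = "of_nat CARD('n) :: complex"
  have "(?N - 1) * cpartial i (\<psi> j) z =
      (?N - 1) * ((\<Sum>k\<in>UNIV. \<psi> k z * schwarzian_deriv k i j f z) + \<psi> i z * \<psi> j z) +
      ((\<Sum>k\<in>UNIV. cpartial k (schwarzian_deriv k i j f) z) -
       (\<Sum>p\<in>UNIV. \<Sum>k\<in>UNIV. schwarzian_deriv p i k f z * schwarzian_deriv k p j f z))"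
  proof (rule traced_flatness[where G = "\<lambda>k i j. \<Gamma> k i j z" and dG = "\<lambda>m k i j. cpartial m (\<Gamma> k i j) z"
        and S = "\<lambda>k i j. schwarzian_deriv k i j f z"
        and dS = "\<lambda>m k i j. cpartial m (schwarzian_deriv k i j f) z"
        and \<psi> = "\<lambda>j. \<psi> j z" and d\<psi> = "\<lambda>i j. cpartial i (\<psi> j) z"])
    show "cpartial m (\<Gamma> p i j) z = cpartial m (schwarzian_deriv p i j f) z +
        ((if p = i then cpartial m (\<psi> j) z else 0) + (if p = j then cpartial m (\<psi> i) z else 0))"
      for m p i j
    proof -
      have 1: "cdiff_on (\<lambda>z. if P then \<psi> j z else 0) U"
        and 2: "cpartial m (\<lambda>z. if P then \<psi> j z else 0) z = (if P then cpartial m (\<psi> j) z else 0)"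
        for P j
        by (cases P; simp add: cdiff_\<psi> cdiff_on_const cpartial_const)+
      show ?thesis
        unfolding schwarzian_deriv_eq[abs_def] cpartial_diff[OF cdiff_\<Gamma> cdiff_on_add[OF 1 1] z]
          cpartial_add[OF 1 1 z] 2 by simp
    qed
    show "cpartial m (\<Gamma> p i j) z = cpartial m (\<Gamma> p j i) z" for m p i j
      by (rule cpartial_cong[OF open_U z \<Gamma>_sym])
    show "(\<Sum>p\<in>UNIV. cpartial i (\<Gamma> p p j) z) = (?N + 1) * cpartial i (\<psi> j) z" for i j
    proof -
      have "(\<Sum>p\<in>UNIV. cpartial i (\<Gamma> p p j) z) = cpartial i (\<lambda>z. \<Sum>p\<in>UNIV. \<Gamma> p p j z) z"
        by (rule cpartial_sum[OF cdiff_\<Gamma> z, symmetric])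
      also have "\<dots> = cpartial i (\<lambda>z. (?N + 1) * \<psi> j z) z"
        by (rule cpartial_cong[OF open_U z \<Gamma>_trace])
      finally show ?thesis by (simp add: cpartial_cmult[OF cdiff_\<psi> z])
    qed
    show "\<Gamma> p i j z = schwarzian_deriv p i j f z +
        ((if p = i then \<psi> j z else 0) + (if p = j then \<psi> i z else 0))" for p i j
      unfolding schwarzian_deriv_eq by simp
    show "(\<Sum>p\<in>UNIV. \<Gamma> p p j z) = (?N + 1) * \<psi> j z" for j
      by (rule \<Gamma>_trace[OF z])
  qed (rule \<Gamma>_flat[OF z] \<Gamma>_sym[OF z])+
  moreover have "?N - 1 \<noteq> 0" using n by auto
  ultimately show ?thesis
    unfolding Q_def by (simp add: field_simps)
qed

end

section \<open>Coefficient bounds\<close>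

lemma open_polydisk: "open (polydisk :: (complex ^ 'n) set)"
proof -
  have "polydisk = (\<Inter>i. (\<lambda>z :: complex ^ 'n. cmod (z $ i)) -` {..<1})"
    by (auto simp: polydisk_def)
  moreover have "open (\<Inter>i. (\<lambda>z :: complex ^ 'n. cmod (z $ i)) -` {..<1})"
    by (intro open_INT ballI open_vimage continuous_intros) simp_all
  ultimately show ?thesis by simp
qed

lemma mem_polydiskI:
  fixes z :: "complex ^ 'n"
  assumes "\<And>i. cmod (z $ i) \<le> 1 / 2"
  shows "z \<in> polydisk"
  unfolding polydisk_def mem_Collect_eq by (intro allI le_less_trans[OF assms]) simp

lemma bergman_norm_scale: "bergman_norm z (c *s v) = cmod c * bergman_norm z v"
proof -
  have "(\<Sum>i\<in>UNIV. (cmod ((c *s v) $ i))\<^sup>2 / (1 - (cmod (z $ i))\<^sup>2)\<^sup>2) =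
      (cmod c)\<^sup>2 * (\<Sum>i\<in>UNIV. (cmod (v $ i))\<^sup>2 / (1 - (cmod (z $ i))\<^sup>2)\<^sup>2)"
    by (simp add: norm_mult power_mult_distrib sum_distrib_left)
  then show ?thesis
    by (simp add: bergman_norm_def real_sqrt_mult)
qed

lemma norm_le_bergman_norm:
  fixes z v :: "complex ^ 'n"
  assumes "z \<in> polydisk"
  shows "norm v \<le> bergman_norm z v"
  unfolding norm_vec_def L2_set_def bergman_norm_def
proof (rule real_sqrt_le_mono)
  have "(cmod (v $ i))\<^sup>2 \<le> (cmod (v $ i))\<^sup>2 / (1 - (cmod (z $ i))\<^sup>2)\<^sup>2" for i
  proof -
    have "(cmod (z $ i))\<^sup>2 < 1"
      using assms by (simp add: polydisk_def abs_square_less_1)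
    then have "0 < (1 - (cmod (z $ i))\<^sup>2)\<^sup>2" "(1 - (cmod (z $ i))\<^sup>2)\<^sup>2 \<le> 1"
      by (auto simp: power_le_one)
    then show ?thesis
      by (simp add: le_divide_eq mult_left_le)
  qed
  then have "(\<Sum>i\<in>UNIV. (cmod (v $ i))\<^sup>2) \<le> (\<Sum>i\<in>UNIV. (cmod (v $ i))\<^sup>2 / (1 - (cmod (z $ i))\<^sup>2)\<^sup>2)"
    by (rule sum_mono)
  moreover have "0 \<le> (\<Sum>i\<in>UNIV. (cmod (v $ i))\<^sup>2 / (1 - (cmod (z $ i))\<^sup>2)\<^sup>2)"
    by (intro sum_nonneg) simp
  ultimately show "(\<Sum>i\<in>UNIV. (cmod (v $ i))\<^sup>2) \<le>
      2 * (\<Sum>i\<in>UNIV. (cmod (v $ i))\<^sup>2 / (1 - (cmod (z $ i))\<^sup>2)\<^sup>2)"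
    by linarith
qed

text \<open>Here \<open>1 - (cmod (z $ i))\<^sup>2\<close> is at least 3/4, and its square 9/16
  exceeds 1/2; the resulting factor 2 is doubled by the 2 in the Bergman norm.\<close>

lemma bergman_norm_le:
  fixes z v :: "complex ^ 'n"
  assumes "\<And>i. cmod (z $ i) \<le> 1 / 2"
  shows "(bergman_norm z v)\<^sup>2 \<le> 4 * (norm v)\<^sup>2"
proof -
  have "(cmod (v $ i))\<^sup>2 / (1 - (cmod (z $ i))\<^sup>2)\<^sup>2 \<le> 2 * (cmod (v $ i))\<^sup>2" for i
  proof -
    have "(cmod (z $ i))\<^sup>2 \<le> (1 / 2)\<^sup>2"
      by (intro power_mono assms) simp
    then have "(3 / 4)\<^sup>2 \<le> (1 - (cmod (z $ i))\<^sup>2)\<^sup>2"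
      by (intro power_mono) (auto simp: power2_eq_square)
    then have *: "1 / 2 \<le> (1 - (cmod (z $ i))\<^sup>2)\<^sup>2" by (simp add: power2_eq_square)
    then have "(cmod (v $ i))\<^sup>2 / (1 - (cmod (z $ i))\<^sup>2)\<^sup>2 \<le> (cmod (v $ i))\<^sup>2 / (1 / 2)"
      by (intro divide_left_mono) auto
    then show ?thesis by simp
  qed
  then have "(\<Sum>i\<in>UNIV. (cmod (v $ i))\<^sup>2 / (1 - (cmod (z $ i))\<^sup>2)\<^sup>2) \<le>
      (\<Sum>i\<in>UNIV. 2 * (cmod (v $ i))\<^sup>2)"
    by (rule sum_mono)
  moreover have "0 \<le> (\<Sum>i\<in>UNIV. (cmod (v $ i))\<^sup>2 / (1 - (cmod (z $ i))\<^sup>2)\<^sup>2)"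
    by (intro sum_nonneg) simp
  ultimately show ?thesis
    by (simp add: bergman_norm_def norm_vec_def L2_set_def sum_nonneg sum_distrib_left[symmetric])
qed

lemma schwarzian_op_scale: "schwarzian_op f z (c *s v) = c\<^sup>2 *s schwarzian_op f z v"
  by (simp add: schwarzian_op_def vec_eq_iff sum_distrib_left power2_eq_square mult_ac)

text \<open>The operator is homogeneous of degree 2 and the norm of degree 1, so the supremum over
  unit vectors controls every \<open>v\<close> after rescaling.\<close>

lemma schwarzian_op_bergman_bound:
  fixes f :: "complex ^ 'n \<Rightarrow> complex ^ 'n"
  assumes \<alpha>: "schwarzian_norm f \<le> ereal \<alpha>" and z: "z \<in> polydisk"
  shows "bergman_norm z (schwarzian_op f z v) \<le> \<alpha> * (bergman_norm z v)\<^sup>2"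
proof (cases "v = 0")
  case True
  then show ?thesis
    using schwarzian_op_scale[of f z 0 v] bergman_norm_scale[of z 0 v]
    by (simp add: bergman_norm_def)
next
  case False
  define b where "b = bergman_norm z v"
  have b: "b > 0"
    using norm_le_bergman_norm[OF z, of v] False unfolding b_def
    by (meson less_le_trans zero_less_norm_iff)
  define w where "w = complex_of_real (1 / b) *s v"
  have vw: "v = complex_of_real b *s w"
    using b by (simp add: w_def vector_smult_assoc)
  have "bergman_norm z w = 1"
    unfolding w_def bergman_norm_scale using b by (simp add: b_def[symmetric] norm_divide)
  then have "ereal (bergman_norm z (schwarzian_op f z w)) \<le> schwarzian_norm_at f z"
    unfolding schwarzian_norm_at_def by (intro SUP_upper) simp
  also have "\<dots> \<le> schwarzian_norm f"
    unfolding schwarzian_norm_def by (intro SUP_upper z)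
  finally have *: "bergman_norm z (schwarzian_op f z w) \<le> \<alpha>"
    using \<alpha> by (metis ereal_less_eq(3) order_trans)
  have "bergman_norm z (schwarzian_op f z v) = b\<^sup>2 * bergman_norm z (schwarzian_op f z w)"
    unfolding vw schwarzian_op_scale bergman_norm_scale by (simp add: norm_power)
  then show ?thesis
    using * b by (simp add: b_def[symmetric] mult.commute)
qed

lemma schwarzian_op_axes:
  "schwarzian_op f z (axis i 1) $ k = schwarzian_deriv k i i f z"
  "schwarzian_op f z (axis i 1 + axis j 1) $ k = schwarzian_deriv k i i f z + schwarzian_deriv k i j f z
    + (schwarzian_deriv k j i f z + schwarzian_deriv k j j f z)"
  by (simp_all add: schwarzian_op_def axis_def if_distrib[of "\<lambda>x. _ * x"] if_distrib[of "\<lambda>x. x * _"]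
      distrib_left distrib_right sum.distrib cong: if_cong)

section \<open>Bounds for the Schwarzian derivatives and for \<open>Q\<close> near the
  origin\<close>

locale bounded_schwarzian = locally_biholomorphic f "polydisk"
  for f :: "complex ^ 'n \<Rightarrow> complex ^ 'n" +
  fixes \<alpha> :: real
  assumes norm_le: "schwarzian_norm f \<le> ereal \<alpha>"
    and card_ge: "CARD('n) \<ge> 2" and \<alpha>_nonneg: "\<alpha> \<ge> 0"
begin

text \<open>Polarisation: twice the mixed entry is the form at \<open>axis i 1 + axis j 1\<close>
  minus its values at the two axes. The bounds \<open>16 * \<alpha>\<close>,
  \<open>4 * \<alpha>\<close> and \<open>4 * \<alpha>\<close> add up to
  \<open>24 * \<alpha>\<close>, which is then halved.\<close>

lemma schwarzian_deriv_bound: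
  fixes z :: "complex ^ 'n"
  assumes z: "\<And>i. cmod (z $ i) \<le> 1 / 2"
  shows "cmod (schwarzian_deriv k i j f z) \<le> 12 * \<alpha>"
proof -
  have zp: "z \<in> polydisk"
    by (rule mem_polydiskI[OF z])
  have bd: "cmod (schwarzian_op f z v $ k) \<le> 4 * \<alpha> * (norm v)\<^sup>2" for v
  proof -
    have "cmod (schwarzian_op f z v $ k) \<le> norm (schwarzian_op f z v)"
      by (rule Finite_Cartesian_Product.norm_nth_le)
    also have "\<dots> \<le> bergman_norm z (schwarzian_op f z v)"
      by (rule norm_le_bergman_norm[OF zp])
    also have "\<dots> \<le> \<alpha> * (bergman_norm z v)\<^sup>2"
      by (rule schwarzian_op_bergman_bound[OF norm_le zp])
    also have "\<dots> \<le> \<alpha> * (4 * (norm v)\<^sup>2)"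
      by (intro mult_left_mono bergman_norm_le z \<alpha>_nonneg)
    finally show ?thesis by simp
  qed
  have ii: "cmod (schwarzian_deriv k i i f z) \<le> 4 * \<alpha>" for i
    using bd[of "axis i 1"] by (simp add: schwarzian_op_axes)
  have "norm (axis i 1 + axis j 1 :: complex ^ 'n) \<le> 2"
    using norm_triangle_ineq[of "axis i (1 :: complex) :: complex ^ 'n" "axis j 1"] by simp
  then have "(norm (axis i 1 + axis j 1 :: complex ^ 'n))\<^sup>2 \<le> 2\<^sup>2"
    by (intro power_mono) auto
  then have "4 * \<alpha> * (norm (axis i 1 + axis j 1 :: complex ^ 'n))\<^sup>2 \<le> 4 * \<alpha> * 2\<^sup>2"
    using \<alpha>_nonneg by (intro mult_left_mono) auto
  then have sum: "cmod (schwarzian_deriv k i i f z + schwarzian_deriv k i j f z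
      + (schwarzian_deriv k j i f z + schwarzian_deriv k j j f z)) \<le> 16 * \<alpha>"
    using bd[of "axis i 1 + axis j 1"] by (simp add: schwarzian_op_axes)
  have "schwarzian_deriv k j i f z = schwarzian_deriv k i j f z"
    using \<Gamma>_sym[OF zp] by (simp add: schwarzian_deriv_eq)
  then have "2 * schwarzian_deriv k i j f z =
      (schwarzian_deriv k i i f z + schwarzian_deriv k i j f z
      + (schwarzian_deriv k j i f z + schwarzian_deriv k j j f z))
      - schwarzian_deriv k i i f z - schwarzian_deriv k j j f z" by simp
  then have "cmod (2 * schwarzian_deriv k i j f z) \<le> 16 * \<alpha> + 4 * \<alpha> + 4 * \<alpha>"
    using sum ii[of i] ii[of j] norm_triangle_ineq4 by (smt (verit))
  then show ?thesis by (simp add: norm_mult)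
qed

text \<open>Cauchy's inequality on discs of radius 1/8, along which all coordinates stay below 1/2
  in modulus; \<open>12 * \<alpha>\<close> is multiplied by 8.\<close>

lemma cpartial_schwarzian_bound:
  fixes z :: "complex ^ 'n"
  assumes z: "\<And>i. cmod (z $ i) \<le> 1 / 4"
  shows "cmod (cpartial m (schwarzian_deriv k i j f) z) \<le> 96 * \<alpha>"
proof -
  have half: "cmod ((z + t *s axis m 1) $ i) \<le> 1 / 2" if "t \<in> cball 0 (1 / 8)" for t i
  proof -
    have "cmod (z $ i + t * axis m 1 $ i) \<le> cmod (z $ i) + cmod (t * axis m 1 $ i)"
      by (rule norm_triangle_ineq)
    also have "cmod (t * axis m 1 $ i) \<le> cmod t" by (simp add: axis_def)
    finally show ?thesis using z[of i] that by simp
  qed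
  have "z + t *s axis m 1 \<in> polydisk" if "t \<in> cball 0 (1 / 8)" for t
    by (rule mem_polydiskI[OF half[OF that]])
  then have D: "\<exists>d. ((\<lambda>t. schwarzian_deriv k i j f (z + t *s axis m 1)) has_field_derivative d) (at t)"
    if "t \<in> cball 0 (1 / 8)" for t
    using cdiff_on_line[OF cdiff_schwarzian] that by blast
  have "cmod ((deriv ^^ 1) (\<lambda>t. schwarzian_deriv k i j f (z + t *s axis m 1)) 0) \<le>
      fact 1 * (12 * \<alpha>) / (1 / 8) ^ 1"
  proof (rule Cauchy_inequality)
    show "(\<lambda>t. schwarzian_deriv k i j f (z + t *s axis m 1)) holomorphic_on ball 0 (1 / 8)"
      unfolding holomorphic_on_open[OF open_ball] using D by auto
    show "continuous_on (cball 0 (1 / 8)) (\<lambda>t. schwarzian_deriv k i j f (z + t *s axis m 1))"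
      using D by (meson DERIV_isCont continuous_at_imp_continuous_on)
    show "cmod (schwarzian_deriv k i j f (z + t *s axis m 1)) \<le> 12 * \<alpha>" if "cmod (0 - t) = 1 / 8" for t
      by (rule schwarzian_deriv_bound[OF half]) (use that in simp)
  qed simp
  then show ?thesis by (simp add: cpartial_def)
qed

text \<open>The numerator of \<open>Q\<close> has n derivatives bounded by
  \<open>96 * \<alpha>\<close> and the square of n many products of two entries bounded by
  \<open>12 * \<alpha>\<close>; its denominator n - 1 is at least 1.\<close>

definition "B = 96 * real CARD('n) * \<alpha> + 144 * (real CARD('n))\<^sup>2 * \<alpha>\<^sup>2"

lemma coefficient_bounds:
  fixes z :: "complex ^ 'n"
  assumes z: "\<And>i. cmod (z $ i) \<le> 1 / 4"
  shows "cmod (schwarzian_deriv k i j f z) \<le> B" and "cmod (Q i j z) \<le> B"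
proof -
  have S: "cmod (schwarzian_deriv k i j f z) \<le> 12 * \<alpha>" for k i j
    by (rule schwarzian_deriv_bound) (rule order_trans[OF z], simp)
  have "12 * \<alpha> \<le> 96 * real CARD('n) * \<alpha>"
    using card_ge \<alpha>_nonneg by (intro mult_right_mono) auto
  also have "\<dots> \<le> B" unfolding B_def by simp
  finally show "cmod (schwarzian_deriv k i j f z) \<le> B" using S[of k i j] by linarith
  let ?D = "\<Sum>k\<in>UNIV. cpartial k (schwarzian_deriv k i j f) z"
  let ?P = "\<Sum>p\<in>UNIV. \<Sum>k\<in>UNIV. schwarzian_deriv p i k f z * schwarzian_deriv k p j f z"
  have P: "cmod (\<Sum>k\<in>UNIV. schwarzian_deriv p i k f z * schwarzian_deriv k p j f z)
      \<le> real CARD('n) * (12 * \<alpha> * (12 * \<alpha>))" for p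
    unfolding norm_mult[symmetric]
    by (rule sum_norm_bound[of UNIV, simplified])
       (simp only: norm_mult, intro mult_mono S, use \<alpha>_nonneg in auto)
  have "cmod ?D \<le> real CARD('n) * (96 * \<alpha>)"
    by (rule sum_norm_bound[of UNIV, simplified]) (rule cpartial_schwarzian_bound[OF z])
  moreover have "cmod ?P \<le> real CARD('n) * (real CARD('n) * (12 * \<alpha> * (12 * \<alpha>)))"
    by (rule sum_norm_bound[of UNIV, simplified]) (rule P)
  ultimately have DP: "cmod (?D - ?P) \<le> B"
    using norm_triangle_ineq4[of ?D ?P] unfolding B_def by (simp add: power2_eq_square mult_ac)
  have "of_nat CARD('n) - 1 = complex_of_real (real CARD('n) - 1)" by simp
  then have "cmod (of_nat CARD('n) - 1) \<ge> 1"
    using card_ge by (simp only: norm_of_real)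
  then have "cmod (?D - ?P) / cmod (of_nat CARD('n) - 1) \<le> cmod (?D - ?P) / 1"
    by (intro divide_left_mono) auto
  then show "cmod (Q i j z) \<le> B"
    unfolding Q_def norm_divide using DP by simp
qed

end

section \<open>The linear system along a complex line\<close>

text \<open>A Gronwall estimate on a short disc. The maximum \<open>M\<close> of all components
  satisfies \<open>M \<le> 1 + C * r * M\<close>, hence \<open>M \<le> 2\<close>, and the
  derivatives are then bounded by \<open>2 * C\<close>.\<close>

lemma linear_ode_bound:
  fixes y :: "'i::finite \<Rightarrow> complex \<Rightarrow> complex"
  assumes D: "\<And>i s. cmod s \<le> r \<Longrightarrow> (y i has_field_derivative y' i s) (at s)"
    and bd: "\<And>i s M. cmod s \<le> r \<Longrightarrow> (\<And>j. cmod (y j s) \<le> M) \<Longrightarrow> cmod (y' i s) \<le> C * M"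
    and init: "\<And>i. cmod (y i 0) \<le> 1"
    and r: "r \<ge> 0" "C \<ge> 0" "C * r \<le> 1 / 2" and s: "cmod s \<le> r"
  shows "cmod (y i s - y i 0) \<le> 2 * C * cmod s"
proof -
  define A where "A = (\<Union>i. (\<lambda>s. cmod (y i s)) ` cball 0 r)"
  have "continuous_on (cball 0 r) (y i)" for i
    using DERIV_isCont[OF D] by (intro continuous_at_imp_continuous_on) simp
  then have "compact A"
    unfolding A_def by (intro compact_UN compact_continuous_image continuous_intros) auto
  moreover have "A \<noteq> {}" using r by (auto simp: A_def)
  ultimately obtain M where M: "M \<in> A" "\<And>x. x \<in> A \<Longrightarrow> x \<le> M"
    using compact_attains_sup by metis
  obtain i0 s0 where M0: "M = cmod (y i0 s0)" "cmod s0 \<le> r"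
    using M(1) by (auto simp: A_def)
  have le: "cmod (y j s) \<le> M" if "cmod s \<le> r" for j s
    by (rule M(2)) (unfold A_def, rule UN_I[of j], simp, rule image_eqI[of _ _ s], use that in auto)
  have diff: "cmod (y j s - y j 0) \<le> C * M * cmod s" if "cmod s \<le> r" for j s
  proof -
    have "cmod (y j s - y j 0) \<le> C * M * cmod (s - 0)"
      using that r
      by (intro field_differentiable_bound[of "cball 0 r" "y j" "y' j"] bd le)
         (auto intro: D has_field_derivative_at_within)
    then show ?thesis by simp
  qed
  have "M \<ge> 0" using M0 by simp
  have "M \<le> cmod (y i0 0) + cmod (y i0 s0 - y i0 0)"
    unfolding M0(1) by (metis add_diff_cancel_left' diff_add_cancel norm_triangle_ineq)
  also have "\<dots> \<le> 1 + C * M * r"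
  proof (intro add_mono init)
    have "C * M * cmod s0 \<le> C * M * r"
      using M0(2) \<open>M \<ge> 0\<close> r by (intro mult_left_mono) auto
    then show "cmod (y i0 s0 - y i0 0) \<le> C * M * r" using diff[OF M0(2), of i0] by linarith
  qed
  also have "C * M * r \<le> 1 / 2 * M"
    using mult_right_mono[OF r(3) \<open>M \<ge> 0\<close>] by (simp add: mult_ac)
  finally have "M \<le> 2" by simp
  then have "C * M * cmod s \<le> C * 2 * cmod s"
    using r by (intro mult_left_mono mult_right_mono) auto
  then show ?thesis using diff[OF s, of i] by simp
qed

section \<open>Affine functions of \<open>f\<close> along complex lines through the origin\<close>

context bounded_schwarzian
begin

text \<open>The first summand covers the equation for the function itself, a sum of n unknowns. The
  second covers the equations for its derivatives: n directions, each with n Schwarzian coefficients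
  and one entry of \<open>Q\<close>.\<close>

definition "C = real CARD('n) + real CARD('n) * (real CARD('n) + 1) * B"

lemma B_nonneg: "B \<ge> 0"
  using \<alpha>_nonneg by (simp add: B_def)

lemma C_ge_1: "C \<ge> 1"
proof -
  have "0 \<le> real CARD('n) * (real CARD('n) + 1) * B" using B_nonneg by simp
  then show ?thesis using card_ge unfolding C_def by linarith
qed

lemma line_coordinate_bound:
  fixes v :: "complex ^ 'n"
  assumes "norm v \<le> 1" "cmod s \<le> a"
  shows "cmod ((s *s v) $ i) \<le> a"
proof -
  have "cmod ((s *s v) $ i) \<le> norm (s *s v)" by (rule Finite_Cartesian_Product.norm_nth_le)
  also have "\<dots> \<le> cmod s * 1" unfolding norm_cvec_scale using assms by (intro mult_left_mono) auto
  finally show ?thesis using assms by simp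
qed

lemma line_in_polydisk:
  fixes v :: "complex ^ 'n"
  assumes "norm v \<le> 1" "cmod s \<le> 1 / 2"
  shows "s *s v \<in> polydisk"
  by (rule mem_polydiskI[OF line_coordinate_bound[OF assms]])

text \<open>\<open>\<phi>\<close> is a branch of \<open>J\<^sub>f\<close> to the power \<open>- 1 / (n + 1)\<close>, chosen separately on each line.\<close>

lemma ex_line_multiplier:
  fixes v :: "complex ^ 'n"
  assumes v: "norm v \<le> 1"
  obtains \<phi> where "\<phi> 0 = 1" "\<And>s. \<phi> s \<noteq> 0"
    "\<And>s. cmod s < 1 / 2 \<Longrightarrow>
       (\<phi> has_field_derivative - \<phi> s * (\<Sum>i\<in>UNIV. \<psi> i (s *s v) * v $ i)) (at s)"
proof -
  define q where "q s = (\<Sum>i\<in>UNIV. \<psi> i (s *s v) * v $ i)" for s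
  have "\<exists>d. (q has_field_derivative d) (at s)" if s: "s \<in> ball 0 (1 / 2)" for s
  proof -
    have d: "((\<lambda>s. \<psi> i (s *s v)) has_field_derivative (\<Sum>j\<in>UNIV. cpartial j (\<psi> i) (s *s v) * v $ j)) (at s)" for i
      using cdiff_on_line[OF cdiff_\<psi>, of 0 s v i] line_in_polydisk[OF v, of s] s by simp
    show ?thesis
      unfolding q_def[abs_def] by (rule exI, rule DERIV_sum, rule DERIV_cmult_right) (rule d)
  qed
  then have "q holomorphic_on ball 0 (1 / 2)"
    unfolding holomorphic_on_open[OF open_ball] by blast
  \<comment> \<open>A primitive exists because the disc is convex; its exponential, normalised at 0,
    never vanishes.\<close>
  then obtain P where P: "\<And>s. s \<in> ball 0 (1 / 2) \<Longrightarrow> (P has_field_derivative q s) (at s)"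
    using holomorphic_convex_primitive'[of "ball 0 (1 / 2)" q] by (auto simp: at_within_open[OF _ open_ball])
  show ?thesis
  proof (rule that[of "\<lambda>s. exp (P 0 - P s)"])
    show "((\<lambda>s. exp (P 0 - P s)) has_field_derivative
        - exp (P 0 - P s) * (\<Sum>i\<in>UNIV. \<psi> i (s *s v) * v $ i)) (at s)" if "cmod s < 1 / 2" for s
      using P[of s] that unfolding q_def[symmetric]
      by (auto intro!: derivative_eq_intros)
  qed simp_all
qed

text \<open>Numerators and denominators of projective images of \<open>f\<close> in one form:
  \<open>c0 = 0\<close> with an axis vector gives a component of \<open>f\<close>, and
  \<open>c0 = 1\<close> gives the denominator of \<open>proj_trans c\<close> at
  \<open>f z\<close>.\<close>

definition aff :: "complex \<Rightarrow> complex ^ 'n \<Rightarrow> complex ^ 'n \<Rightarrow> complex" where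
  "aff c0 c z = c0 + (\<Sum>l\<in>UNIV. c $ l * f z $ l)"

text \<open>\<open>\<phi> * proj_deriv c0 c j\<close> is the \<open>j\<close>-th partial derivative of \<open>\<phi> * aff c0 c\<close>.\<close>

definition proj_deriv :: "complex \<Rightarrow> complex ^ 'n \<Rightarrow> 'n \<Rightarrow> complex ^ 'n \<Rightarrow> complex" where
  "proj_deriv c0 c j z = cpartial j (aff c0 c) z - \<psi> j z * aff c0 c z"

lemma cdiff_aff: "cdiff_on (aff c0 c) polydisk"
  unfolding aff_def[abs_def] by (intro cdiff_on_intros cdiff_f)

lemma cpartial_aff:
  assumes "z \<in> polydisk"
  shows "cpartial j (aff c0 c) z = (\<Sum>l\<in>UNIV. c $ l * D1 j l z)"
proof -
  have "cpartial j (aff c0 c) z = cpartial j (\<lambda>_. c0) z + cpartial j (\<lambda>z. \<Sum>l\<in>UNIV. c $ l * f z $ l) z"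
    unfolding aff_def[abs_def]
    by (intro cpartial_add[OF _ _ assms] cdiff_on_intros cdiff_f)
  also have "\<dots> = (\<Sum>l\<in>UNIV. cpartial j (\<lambda>z. c $ l * f z $ l) z)"
    by (subst cpartial_sum[OF _ assms]) (auto intro: cdiff_on_intros cdiff_f simp: cpartial_const)
  finally show ?thesis by (simp add: cpartial_cmult[OF cdiff_f assms])
qed

lemma cpartial_cpartial_aff:
  assumes z: "z \<in> polydisk"
  shows "cpartial i (cpartial j (aff c0 c)) z = (\<Sum>k\<in>UNIV. cpartial k (aff c0 c) z * \<Gamma> k i j z)"
proof -
  have "cpartial i (cpartial j (aff c0 c)) z = cpartial i (\<lambda>z. \<Sum>l\<in>UNIV. c $ l * D1 j l z) z"
    by (rule cpartial_cong[OF open_polydisk z cpartial_aff])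
  also have "\<dots> = (\<Sum>l\<in>UNIV. c $ l * D2 i j l z)"
    by (subst cpartial_sum[OF _ z])
       (auto intro: cdiff_on_intros cdiff_D1 simp: cpartial_cmult[OF cdiff_D1 z])
  also have "\<dots> = (\<Sum>k\<in>UNIV. (\<Sum>l\<in>UNIV. c $ l * D1 k l z) * \<Gamma> k i j z)"
    unfolding D2_eq[OF z] sum_distrib_left sum_distrib_right
    by (subst sum.swap) (simp add: mult_ac)
  finally show ?thesis by (simp add: cpartial_aff[OF z])
qed

lemma cdiff_proj_deriv: "cdiff_on (proj_deriv c0 c j) polydisk"
  unfolding proj_deriv_def[abs_def]
  by (intro cdiff_on_intros cdiff_on_cpartial cdiff_aff cdiff_\<psi> open_polydisk)

text \<open>The Riccati equation \<open>cpartial_\<psi>\<close> absorbs the terms quadratic in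
  \<open>\<psi>\<close>. The remaining term \<open>\<psi> i z * proj_deriv c0 c j z\<close> is
  cancelled by the derivative of the multiplier \<open>\<phi>\<close>, so only
  \<open>schwarzian_deriv\<close> and \<open>Q\<close> enter the system.\<close>

lemma cpartial_proj_deriv:
  assumes z: "z \<in> polydisk"
  shows "cpartial i (proj_deriv c0 c j) z =
    (\<Sum>k\<in>UNIV. schwarzian_deriv k i j f z * proj_deriv c0 c k z) - Q i j z * aff c0 c z
    + \<psi> i z * proj_deriv c0 c j z"
proof -
  let ?A = "aff c0 c"
  have 1: "cpartial i (proj_deriv c0 c j) z = cpartial i (cpartial j ?A) z -
      (cpartial i (\<psi> j) z * ?A z + \<psi> j z * cpartial i ?A z)"
    unfolding proj_deriv_def[abs_def]
    by (simp add: cpartial_diff[OF _ _ z] cpartial_mult[OF _ _ z] cdiff_on_mult cdiff_\<psi> cdiff_aff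
        cdiff_on_cpartial open_polydisk)
  have 2: "cpartial i (cpartial j ?A) z =
      (\<Sum>k\<in>UNIV. cpartial k ?A z * schwarzian_deriv k i j f z)
      + \<psi> j z * cpartial i ?A z + \<psi> i z * cpartial j ?A z"
  proof -
    have "cpartial i (cpartial j ?A) z = (\<Sum>k\<in>UNIV. cpartial k ?A z * (schwarzian_deriv k i j f z +
        ((if k = i then \<psi> j z else 0) + (if k = j then \<psi> i z else 0))))"
      unfolding cpartial_cpartial_aff[OF z] by (simp add: schwarzian_deriv_eq)
    then show ?thesis
      by (simp add: distrib_left sum.distrib if_distrib[of "\<lambda>x. _ * x"] mult.commute cong: if_cong)
  qed
  have 3: "(\<Sum>k\<in>UNIV. cpartial k ?A z * schwarzian_deriv k i j f z) =
      (\<Sum>k\<in>UNIV. schwarzian_deriv k i j f z * proj_deriv c0 c k z) +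
      (\<Sum>k\<in>UNIV. \<psi> k z * schwarzian_deriv k i j f z) * ?A z"
    by (simp add: proj_deriv_def algebra_simps sum_subtractf sum_distrib_left)
  show ?thesis
    unfolding 1 2 3 cpartial_\<psi>[OF z card_ge, of i j] proj_deriv_def[of c0 c j]
    by (simp add: algebra_simps)
qed

text \<open>Two integrations: the system keeps the first derivatives within \<open>2 * C * r\<close>
  of their initial values, and integrating these once more bounds the deviation from the linear
  part.\<close>

lemma aff_line_estimate:
  fixes v c :: "complex ^ 'n"
  assumes v: "norm v \<le> 1" and \<phi>0: "\<phi> 0 = 1"
    and \<phi>: "\<And>s. cmod s < 1 / 2 \<Longrightarrow>
       (\<phi> has_field_derivative - \<phi> s * (\<Sum>i\<in>UNIV. \<psi> i (s *s v) * v $ i)) (at s)"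
    and r: "r \<ge> 0" "r \<le> 1 / 4" "C * r \<le> 1 / 2" and s: "cmod s \<le> r"
    and init: "cmod (aff c0 c 0) \<le> 1" "\<And>j. cmod (proj_deriv c0 c j 0) \<le> 1"
  shows "cmod (\<phi> s * aff c0 c (s *s v) - aff c0 c 0 - s * (\<Sum>j\<in>UNIV. proj_deriv c0 c j 0 * v $ j))
    \<le> 2 * real CARD('n) * C * r * cmod s"
proof -
  \<comment> \<open>The option type indexes the n + 1 unknowns: \<open>None\<close> is the
    multiplied affine function, \<open>Some j\<close> its derivative in coordinate
    \<open>j\<close>.\<close>
  define y where "y k s = \<phi> s * (case k of None \<Rightarrow> aff c0 c (s *s v) | Some j \<Rightarrow> proj_deriv c0 c j (s *s v))"
    for k s
  define y' where "y' k s = (case k of None \<Rightarrow> (\<Sum>j\<in>UNIV. y (Some j) s * v $ j)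
    | Some j \<Rightarrow> (\<Sum>i\<in>UNIV. ((\<Sum>k\<in>UNIV. schwarzian_deriv k i j f (s *s v) * y (Some k) s)
        - Q i j (s *s v) * y None s) * v $ i))" for k s
  have D: "(y k has_field_derivative y' k s) (at s)" if s: "cmod s \<le> r" for k s
  proof -
    have z: "s *s v \<in> polydisk" by (rule line_in_polydisk[OF v]) (use s r in linarith)
    have D\<phi>: "(\<phi> has_field_derivative - \<phi> s * (\<Sum>i\<in>UNIV. \<psi> i (s *s v) * v $ i)) (at s)"
      by (rule \<phi>) (use s r in linarith)
    have line: "((\<lambda>s. h (s *s v)) has_field_derivative (\<Sum>i\<in>UNIV. cpartial i h (s *s v) * v $ i)) (at s)"
      if "cdiff_on h polydisk" for h
      using cdiff_on_line[OF that, of 0 s v] z by simp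
    show ?thesis
    proof (cases k)
      case None
      have "- \<phi> s * (\<Sum>i\<in>UNIV. \<psi> i (s *s v) * v $ i) * aff c0 c (s *s v) +
          (\<Sum>i\<in>UNIV. cpartial i (aff c0 c) (s *s v) * v $ i) * \<phi> s = y' None s"
        by (simp add: y'_def y_def proj_deriv_def sum_distrib_left sum_distrib_right algebra_simps
            sum_subtractf sum_negf)
      then show ?thesis
        using DERIV_mult[OF D\<phi> line[OF cdiff_aff, of c0 c]] None by (simp add: y_def[abs_def])
    next
      case (Some j)
      have "- \<phi> s * (\<Sum>i\<in>UNIV. \<psi> i (s *s v) * v $ i) * proj_deriv c0 c j (s *s v) +
          (\<Sum>i\<in>UNIV. cpartial i (proj_deriv c0 c j) (s *s v) * v $ i) * \<phi> s = y' (Some j) s"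
        unfolding cpartial_proj_deriv[OF z]
        by (simp add: y'_def y_def sum_distrib_left sum_distrib_right algebra_simps
            sum_subtractf sum.distrib) (simp add: sum_negf)
      then show ?thesis
        using DERIV_mult[OF D\<phi> line[OF cdiff_proj_deriv, of c0 c j]] Some by (simp add: y_def[abs_def])
    qed
  qed
  have vi: "cmod (v $ i) \<le> 1" for i
    using Finite_Cartesian_Product.norm_nth_le[of v i] v by linarith
  have bd: "cmod (y' k s) \<le> C * M" if s: "cmod s \<le> r" and M: "\<And>j. cmod (y j s) \<le> M" for k s M
  proof -
    have M0: "M \<ge> 0" by (rule order_trans[OF norm_ge_zero M])
    have "cmod ((s *s v) $ i) \<le> 1 / 4" for i
      by (rule line_coordinate_bound[OF v]) (use s r in linarith)
    note SQ = coefficient_bounds[OF this]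
    show ?thesis
    proof (cases k)
      case None
      have "cmod (y (Some j) s * v $ j) \<le> M * 1" for j
        unfolding norm_mult by (intro mult_mono M vi M0) simp
      then have "cmod (y' None s) \<le> real CARD('n) * (M * 1)"
        unfolding y'_def option.case by (rule sum_norm_bound[of UNIV, simplified])
      also have "\<dots> \<le> C * M"
        unfolding C_def using B_nonneg M0 by (simp add: distrib_right)
      finally show ?thesis using None by simp
    next
      case (Some j)
      have "cmod ((\<Sum>k\<in>UNIV. schwarzian_deriv k i j f (s *s v) * y (Some k) s)
          - Q i j (s *s v) * y None s) \<le> (real CARD('n) + 1) * B * M" for i
      proof -
        have "cmod (\<Sum>k\<in>UNIV. schwarzian_deriv k i j f (s *s v) * y (Some k) s) \<le> real CARD('n) * (B * M)"
          by (rule sum_norm_bound[of UNIV, simplified])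
             (simp only: norm_mult, intro mult_mono SQ M B_nonneg norm_ge_zero)
        moreover have "cmod (Q i j (s *s v) * y None s) \<le> B * M"
          unfolding norm_mult by (intro mult_mono SQ M B_nonneg norm_ge_zero)
        ultimately show ?thesis
          using norm_triangle_ineq4[of "\<Sum>k\<in>UNIV. schwarzian_deriv k i j f (s *s v) * y (Some k) s"
              "Q i j (s *s v) * y None s"] by (simp add: algebra_simps)
      qed
      then have "cmod (((\<Sum>k\<in>UNIV. schwarzian_deriv k i j f (s *s v) * y (Some k) s)
          - Q i j (s *s v) * y None s) * v $ i) \<le> (real CARD('n) + 1) * B * M * 1" for i
        unfolding norm_mult using M0 B_nonneg by (intro mult_mono vi) auto
      then have "cmod (y' (Some j) s) \<le> real CARD('n) * ((real CARD('n) + 1) * B * M * 1)"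
        unfolding y'_def option.case by (rule sum_norm_bound[of UNIV, simplified])
      also have "\<dots> \<le> C * M"
        unfolding C_def using M0 by (simp add: algebra_simps)
      finally show ?thesis using Some by simp
    qed
  qed
  have y0: "y None 0 = aff c0 c 0" "\<And>j. y (Some j) 0 = proj_deriv c0 c j 0"
    using \<phi>0 by (simp_all add: y_def)
  have y1: "cmod (y k 0) \<le> 1" for k
    using init by (cases k) (simp_all add: y0)
  have ode: "cmod (y k s - y k 0) \<le> 2 * C * cmod s" if "cmod s \<le> r" for k s
    by (rule linear_ode_bound[of r y y' C])
       (fact D bd y1 r that | use C_ge_1 in linarith)+
  define L where "L = (\<Sum>j\<in>UNIV. proj_deriv c0 c j 0 * v $ j)"
  \<comment> \<open>After subtracting the linear part, the derivative along the line contains only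
    the differences \<open>y (Some j) t - y (Some j) 0\<close>, to which the bound
    \<open>ode\<close> applies.\<close>
  have "cmod ((y None s - s * L) - (y None 0 - 0 * L)) \<le> 2 * real CARD('n) * C * r * cmod (s - 0)"
  proof (rule field_differentiable_bound[of "cball 0 r" _ "\<lambda>s. y' None s - L"])
    fix t :: complex assume "t \<in> cball 0 r"
    then have t: "cmod t \<le> r" by simp
    show "((\<lambda>s. y None s - s * L) has_field_derivative y' None t - L) (at t within cball 0 r)"
      using DERIV_diff[OF D[OF t, of None] DERIV_cmult_right[OF DERIV_ident, of L t]]
      by (simp add: has_field_derivative_at_within)
    have "y' None t - L = (\<Sum>j\<in>UNIV. (y (Some j) t - y (Some j) 0) * v $ j)"
      by (simp add: y'_def L_def y0 left_diff_distrib sum_subtractf)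
    also have "cmod \<dots> \<le> real CARD('n) * (2 * C * r)"
    proof (rule sum_norm_bound[of UNIV, simplified])
      fix j
      have "2 * C * cmod t \<le> 2 * C * r" using t C_ge_1 by (intro mult_left_mono) auto
      then have "cmod (y (Some j) t - y (Some j) 0) \<le> 2 * C * r"
        using ode[OF t, of "Some j"] C_ge_1 by linarith
      then have "cmod (y (Some j) t - y (Some j) 0) * cmod (v $ j) \<le> 2 * C * r * 1"
        using C_ge_1 r by (intro mult_mono vi) auto
      then show "cmod ((y (Some j) t - y (Some j) 0) * v $ j) \<le> 2 * C * r"
        by (simp add: norm_mult)
    qed
    finally show "cmod (y' None t - L) \<le> 2 * real CARD('n) * C * r" by (simp add: mult_ac)
  qed (use s r in auto)
  then show ?thesis
    unfolding y0 by (simp add: y_def L_def diff_diff_eq add.commute)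
qed

end

section \<open>Covering\<close>

locale normalized_schwarzian = bounded_schwarzian f \<alpha>
  for f :: "complex ^ 'n \<Rightarrow> complex ^ 'n" and \<alpha> +
  assumes f_0: "f 0 = 0" and jac_0: "cjacobian f 0 = mat 1"
begin

text \<open>Since the Jacobian determinant is 1 at the origin, this is its gradient there divided by
  n + 1, the vector of the normalising transformation.\<close>

definition "a = (\<chi> j. \<psi> j 0)"

lemma zero_in_polydisk: "0 \<in> polydisk"
  by (simp add: polydisk_def)

lemma cgrad_jac_det_0: "cgrad (jac_det f) 0 = of_nat (CARD('n) + 1) *s a"
  by (simp add: cgrad_def a_def \<psi>_def log_cpartial_def jac_det_def[of f 0] jac_0 vec_eq_iff
      del: of_nat_add of_nat_Suc)

lemma aff_0: "aff c0 c 0 = c0"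
  by (simp add: aff_def f_0)

text \<open>The initial data that single out \<open>a\<close>: the denominator
  (\<open>c0 = 1\<close>, \<open>c = a\<close>) starts with zero derivatives, while the numerator
  with \<open>c = axis l 1\<close> starts with those of the coordinate \<open>z $ l\<close>.\<close>

lemma proj_deriv_0: "proj_deriv c0 c j 0 = c $ j - a $ j * c0"
proof -
  have "D1 j l 0 = (if l = j then 1 else 0)" for l
    using jac_0 by (simp add: cjacobian_def mat_def vec_eq_iff)
  then show ?thesis
    by (simp add: proj_deriv_def cpartial_aff[OF zero_in_polydisk] aff_0 a_def
        if_distrib[of "\<lambda>x. _ * x"] cong: if_cong)
qed

text \<open>Chosen to make \<open>2 * (real CARD('n))\<^sup>2 * C * r\<close> equal to 1/8: one
  factor n is in the line estimate, the other comes from summing over the coordinates.\<close>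

definition "r = 1 / (16 * (real CARD('n))\<^sup>2 * C)"

lemma r_bounds: "r > 0" "r \<le> 1 / 4" "C * r \<le> 1 / 2" "2 * (real CARD('n))\<^sup>2 * C * r = 1 / 8"
proof -
  have n: "(real CARD('n))\<^sup>2 \<ge> 1" using card_ge by (simp add: one_le_power)
  then have p: "(real CARD('n))\<^sup>2 * C \<ge> 1 * 1"
    using C_ge_1 by (intro mult_mono) auto
  show "r > 0" "2 * (real CARD('n))\<^sup>2 * C * r = 1 / 8"
    using n C_ge_1 unfolding r_def by (auto simp: field_simps)
  show "r \<le> 1 / 4"
    unfolding r_def using p by (auto simp: field_simps)
  have "C * r = 1 / (16 * (real CARD('n))\<^sup>2)"
    using C_ge_1 by (simp add: r_def)
  also have "\<dots> \<le> 1 / 2"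
    using n by (intro divide_left_mono) linarith+
  finally show "C * r \<le> 1 / 2" .
qed

text \<open>The multiplier \<open>\<phi> s\<close> cancels in the quotient. Its numerator is within
  \<open>r / 8\<close> of \<open>z\<close> and its denominator \<open>u\<close> within 1/8 of 1, so
  the error is at most \<open>2 * (r / 8 + 1 / 8 * r)\<close>.\<close>

lemma near_identity:
  assumes z: "norm z \<le> r"
  shows "aff 1 a z \<noteq> 0" and "norm (inverse (aff 1 a z) *s f z - z) \<le> r / 2"
proof -
  let ?n = "real CARD('n)"
  define s where "s = complex_of_real (norm z)"
  \<comment> \<open>For \<open>z = 0\<close> the convention \<open>inverse 0 = 0\<close> makes
    \<open>v\<close> the zero vector; hence only \<open>norm v \<le> 1\<close> is claimed.\<close>
  define v where "v = complex_of_real (inverse (norm z)) *s z"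
  have v: "norm v \<le> 1" by (cases "z = 0") (simp_all add: v_def norm_cvec_scale norm_inverse)
  have sv: "s *s v = z" by (cases "z = 0") (simp_all add: s_def v_def vector_smult_assoc flip: of_real_mult)
  have s: "cmod s \<le> r" using z by (simp add: s_def)
  obtain \<phi> where \<phi>: "\<phi> 0 = 1" "\<And>s. \<phi> s \<noteq> 0"
    "\<And>s. cmod s < 1 / 2 \<Longrightarrow>
       (\<phi> has_field_derivative - \<phi> s * (\<Sum>i\<in>UNIV. \<psi> i (s *s v) * v $ i)) (at s)"
    using ex_line_multiplier[OF v] by blast
  note est = aff_line_estimate[OF v \<phi>(1,3) less_imp_le[OF r_bounds(1)] r_bounds(2,3) s,
      unfolded sv aff_0 proj_deriv_0]
  define \<epsilon> where "\<epsilon> = 2 * ?n * C * r * cmod s"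
  have n\<epsilon>: "?n * \<epsilon> \<le> r / 8"
  proof -
    have "?n * \<epsilon> = 2 * ?n\<^sup>2 * C * r * cmod s" by (simp add: \<epsilon>_def power2_eq_square)
    then show ?thesis using r_bounds(4) s by simp
  qed
  have "1 * \<epsilon> \<le> ?n * \<epsilon>"
    using card_ge C_ge_1 r_bounds(1) by (intro mult_right_mono) (auto simp: \<epsilon>_def)
  with n\<epsilon> have \<epsilon>: "\<epsilon> \<le> r / 8" by simp
  define u where "u = \<phi> s * aff 1 a z"
  \<comment> \<open>With \<open>c0 = 1\<close> and \<open>c = a\<close> the linear term of the
    estimate vanishes.\<close>
  have u: "cmod (u - 1) \<le> 1 / 8"
    using est[of 1 a] \<epsilon> r_bounds(2) by (simp add: u_def \<epsilon>_def)
  have "cmod (\<phi> s * f z $ l - z $ l) \<le> \<epsilon>" for l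
  proof -
    have "aff 0 (axis l 1) z = f z $ l"
      by (simp add: aff_def axis_def if_distrib[of "\<lambda>x. x * _"] cong: if_cong)
    moreover have "s * (\<Sum>j\<in>UNIV. axis l 1 $ j * v $ j) = z $ l"
      unfolding sv[symmetric] by (simp add: axis_def if_distrib[of "\<lambda>x. x * _"] cong: if_cong)
    moreover have "cmod (axis l 1 $ j) \<le> 1" for j
      by (simp add: axis_def)
    ultimately show ?thesis using est[of 0 "axis l 1"] by (simp add: \<epsilon>_def)
  qed
  then have "norm (\<phi> s *s f z - z) \<le> (\<Sum>l\<in>(UNIV :: 'n set). \<epsilon>)"
    unfolding norm_vec_def
    by (intro order_trans[OF L2_set_le_sum sum_mono]) auto
  then have 1: "norm (\<phi> s *s f z - z) \<le> r / 8" using n\<epsilon> by simp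
  have u78: "cmod u \<ge> 7 / 8"
    using u norm_triangle_ineq2[of 1 "1 - u"] by (simp add: norm_minus_commute)
  then have u0: "u \<noteq> 0" by auto
  then show "aff 1 a z \<noteq> 0" by (auto simp: u_def)
  have "inverse (aff 1 a z) *s f z - z = inverse u *s (\<phi> s *s f z - z + (1 - u) *s z)"
    using u0 \<phi>(2)[of s] by (simp add: u_def vec_eq_iff field_simps)
  moreover have "norm ((1 - u) *s z) \<le> 1 / 8 * r"
    unfolding norm_cvec_scale using u z by (intro mult_mono) (auto simp: norm_minus_commute)
  then have "norm (\<phi> s *s f z - z + (1 - u) *s z) \<le> r / 8 + 1 / 8 * r"
    by (rule norm_triangle_mono[OF 1])
  moreover have "cmod (inverse u) \<le> 2"
    using u78 le_imp_inverse_le[of "1/2" "cmod u"] by (simp add: norm_inverse)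
  ultimately have "norm (inverse (aff 1 a z) *s f z - z) \<le> 2 * (r / 8 + 1 / 8 * r)"
    unfolding norm_cvec_scale by (simp only: norm_cvec_scale) (intro mult_mono; simp)
  then show "norm (inverse (aff 1 a z) *s f z - z) \<le> r / 2" by simp
qed

lemma ball_covered:
  assumes w: "norm w < r / 2"
  shows "\<exists>z\<in>polydisk. aff 1 a z \<noteq> 0 \<and> inverse (aff 1 a z) *s f z = w"
proof -
  have sub: "cball 0 r \<subseteq> (polydisk :: (complex ^ 'n) set)"
  proof
    fix z :: "complex ^ 'n" assume "z \<in> cball 0 r"
    then have "cmod (z $ i) \<le> 1 / 2" for i
      using Finite_Cartesian_Product.norm_nth_le[of z i] r_bounds(2) by simp
    then show "z \<in> polydisk" by (rule mem_polydiskI)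
  qed
  \<comment> \<open>A fixed point of \<open>F\<close> solves the equation for \<open>w\<close>. By
    \<open>near_identity\<close> the first part of \<open>F\<close> has norm at most
    \<open>r / 2\<close>, which leaves room for \<open>w\<close> in
    \<open>cball 0 r\<close>.\<close>
  define F where "F z = z - inverse (aff 1 a z) *s f z + w" for z
  have "continuous_on (cball 0 r) F"
  proof -
    have 1: "continuous_on (cball 0 r) (aff 1 a)"
      by (rule cdiff_on_imp_continuous_on[OF cdiff_on_subset[OF cdiff_aff sub]])
    have 2: "continuous_on (cball 0 r) (\<lambda>z. f z $ l)" for l
      by (rule cdiff_on_imp_continuous_on[OF cdiff_on_subset[OF cdiff_f sub]])
    have "continuous_on (cball 0 r) (\<lambda>z. \<chi> l. inverse (aff 1 a z) * f z $ l)"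
      by (intro continuous_on_vec_lambda continuous_on_mult continuous_on_inverse 1 2)
        (use near_identity in auto)
    then have "continuous_on (cball 0 r) (\<lambda>z. inverse (aff 1 a z) *s f z)"
      by (simp add: vector_scalar_mult_def)
    then show ?thesis unfolding F_def by (intro continuous_intros)
  qed
  moreover have "F z \<in> cball 0 r" if "z \<in> cball 0 r" for z
  proof -
    have "norm (F z) \<le> norm (z - inverse (aff 1 a z) *s f z) + norm w"
      unfolding F_def by (rule norm_triangle_ineq)
    also have "\<dots> \<le> r / 2 + r / 2"
      using near_identity(2)[of z] that w by (simp add: norm_minus_commute)
    finally show ?thesis by simp
  qed
  ultimately obtain z where z: "z \<in> cball 0 r" "F z = z"
    using brouwer[of "cball 0 r" F] r_bounds(1) by (auto simp: Pi_iff)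
  then have "inverse (aff 1 a z) *s f z = w" by (simp add: F_def)
  then show ?thesis using z(1) near_identity(1)[of z] sub by auto
qed

lemma aff_1: "aff 1 a z = 1 + (\<Sum>i\<in>UNIV. a $ i * f z $ i)"
  by (simp add: aff_def)

lemma ball_subset_ran: "ball 0 (r / 2) \<subseteq> ran (proj_trans a \<circ>\<^sub>m ((Some \<circ> f) |` polydisk))"
proof
  fix w :: "complex ^ 'n" assume "w \<in> ball 0 (r / 2)"
  then obtain z where "z \<in> polydisk" "aff 1 a z \<noteq> 0" "inverse (aff 1 a z) *s f z = w"
    using ball_covered[of w] by auto
  then have "(proj_trans a \<circ>\<^sub>m ((Some \<circ> f) |` polydisk)) z = Some w"
    by (simp add: map_comp_def proj_trans_def Let_def aff_1)
  then show "w \<in> ran (proj_trans a \<circ>\<^sub>m ((Some \<circ> f) |` polydisk))"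
    by (rule ranI)
qed

section \<open>The order of the family and the image of \<open>f\<close>\<close>

lemma dot_scale:
  fixes w :: "complex ^ 'n"
  shows "(\<Sum>i\<in>UNIV. a $ i * (c *s w) $ i) = c * (\<Sum>i\<in>UNIV. a $ i * w $ i)"
  by (simp add: sum_distrib_left mult_ac)

text \<open>The value is never 1, which excludes a hyperplane from the image; it also recovers the
  denominator from the image point alone.\<close>

lemma inverse_aff_dot:
  assumes "aff 1 a z \<noteq> 0"
  shows "(\<Sum>i\<in>UNIV. a $ i * (inverse (aff 1 a z) *s f z) $ i) = 1 - inverse (aff 1 a z)"
proof -
  have "(\<Sum>i\<in>UNIV. a $ i * (inverse (aff 1 a z) *s f z) $ i) = inverse (aff 1 a z) * (aff 1 a z - 1)"
    unfolding dot_scale by (simp add: aff_1)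
  then show ?thesis using assms by (simp add: field_simps)
qed

text \<open>The hyperplane \<open>\<Sum> a\<^sub>i w\<^sub>i = 1\<close> is the image of the hyperplane at infinity under \<open>proj_trans a\<close>,
  so it misses the image of the finite-valued map \<open>f\<close>.\<close>

lemma norm_a_le: "norm a \<le> 2 / r"
proof (rule ccontr)
  assume *: "\<not> norm a \<le> 2 / r"
  have "0 < 2 / r" using r_bounds(1) by simp
  with * have a: "norm a > 0" by linarith
  \<comment> \<open>The point of the excluded hyperplane closest to the origin, at distance
    \<open>1 / norm a\<close>.\<close>
  define w where "w = complex_of_real (1 / (norm a)\<^sup>2) *s (\<chi> i. cnj (a $ i))"
  have "norm w = 1 / (norm a)\<^sup>2 * norm a"
    unfolding w_def norm_cvec_scale by (simp add: norm_divide norm_power) (simp add: norm_vec_def)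
  also have "\<dots> = 1 / norm a" using a by (simp add: power2_eq_square)
  also have "\<dots> < r / 2"
    using * a r_bounds(1) by (simp add: field_simps)
  finally obtain z where z: "aff 1 a z \<noteq> 0" "inverse (aff 1 a z) *s f z = w"
    using ball_covered by blast
  have "(\<Sum>i\<in>UNIV. a $ i * w $ i) = complex_of_real (1 / (norm a)\<^sup>2) * (\<Sum>i\<in>UNIV. a $ i * cnj (a $ i))"
    by (simp add: w_def sum_distrib_left mult_ac)
  also have "(\<Sum>i\<in>UNIV. a $ i * cnj (a $ i)) = complex_of_real ((norm a)\<^sup>2)"
    by (simp add: complex_norm_square[symmetric] norm_vec_def L2_set_def sum_nonneg)
  finally have "(\<Sum>i\<in>UNIV. a $ i * w $ i) = 1" using a by simp
  then show False using inverse_aff_dot[OF z(1)] z by simp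
qed

lemma norm_dot_le:
  fixes w :: "complex ^ 'n"
  shows "cmod (\<Sum>i\<in>UNIV. a $ i * w $ i) \<le> norm a * norm w"
proof -
  have "cmod (\<Sum>i\<in>UNIV. a $ i * w $ i) \<le> (\<Sum>i\<in>UNIV. \<bar>cmod (a $ i)\<bar> * \<bar>cmod (w $ i)\<bar>)"
    by (rule order_trans[OF norm_sum]) (simp add: norm_mult)
  also have "\<dots> \<le> norm a * norm w"
    unfolding norm_vec_def by (rule L2_set_mult_ineq)
  finally show ?thesis .
qed

text \<open>For small \<open>w\<close> the bound on \<open>a\<close> keeps the denominator
  \<open>d\<close> at least 1/2 in modulus, so the image of \<open>w\<close> under
  \<open>proj_trans a\<close> lies in the ball already covered. Injectivity of
  \<open>proj_trans a\<close> then carries the covering back to \<open>f\<close>.\<close>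

lemma ball_subset_image: "ball 0 (r / 4) \<subseteq> f ` polydisk"
proof
  fix w :: "complex ^ 'n" assume "w \<in> ball 0 (r / 4)"
  then have w: "norm w < r / 4" by simp
  define d where "d = 1 + (\<Sum>i\<in>UNIV. a $ i * w $ i)"
  have "cmod (\<Sum>i\<in>UNIV. a $ i * w $ i) \<le> norm a * norm w" by (rule norm_dot_le)
  also have "\<dots> \<le> 2 / r * (r / 4)"
    using norm_a_le w r_bounds(1) by (intro mult_mono) auto
  finally have "cmod (\<Sum>i\<in>UNIV. a $ i * w $ i) \<le> 1 / 2" using r_bounds(1) by simp
  then have d: "cmod d \<ge> 1 / 2"
    using norm_triangle_ineq2[of 1 "1 - d"] unfolding d_def by (simp add: norm_minus_commute)
  then have d0: "d \<noteq> 0" by auto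
  have "cmod (inverse d) \<le> 2"
    using d le_imp_inverse_le[of "1/2" "cmod d"] by (simp add: norm_inverse)
  then have "norm (inverse d *s w) \<le> 2 * norm w"
    unfolding norm_cvec_scale by (intro mult_right_mono) auto
  then have "norm (inverse d *s w) < r / 2" using w by simp
  then obtain z where z: "z \<in> polydisk" "aff 1 a z \<noteq> 0" "inverse (aff 1 a z) *s f z = inverse d *s w"
    using ball_covered by blast
  have "(\<Sum>i\<in>UNIV. a $ i * (inverse d *s w) $ i) = inverse d * (d - 1)"
    unfolding dot_scale by (simp add: d_def)
  also have "\<dots> = 1 - inverse d"
    using d0 by (simp add: right_diff_distrib)
  \<comment> \<open>Both dot products have the form one minus an inverse denominator, so equal image
    points force equal denominators.\<close>
  finally have "aff 1 a z = d"
    using inverse_aff_dot[OF z(2)] unfolding z(3) by simp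
  then have "f z $ i = w $ i" for i
    using z(3) d0 by (simp add: vec_eq_iff)
  then have "f z = w" by (simp add: vec_eq_iff)
  then show "w \<in> f ` polydisk" using z(1) by blast
qed

end

section \<open>Choice of the uniform constant\<close>

theorem theorem3p6:
  fixes \<alpha> :: real
  assumes "CARD('n::finite) \<ge> 2" and "\<alpha> \<ge> 0"
  shows "\<exists>s\<^sub>0 :: real. s\<^sub>0 > 0 \<and>
    family_order (schwarz_family \<alpha> :: (complex ^ 'n \<Rightarrow> complex ^ 'n) set) < \<infinity> \<and>
    family_order (schwarz_family \<alpha> :: (complex ^ 'n \<Rightarrow> complex ^ 'n) set) \<le> ereal (1 / s\<^sub>0) \<and>
    (\<forall>g \<in> (schwarz_family0 \<alpha> :: (complex ^ 'n \<rightharpoonup> complex ^ 'n) set). ball 0 s\<^sub>0 \<subseteq> ran g) \<and>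
    (\<forall>f \<in> (schwarz_family \<alpha> :: (complex ^ 'n \<Rightarrow> complex ^ 'n) set).
       ball 0 (s\<^sub>0 / 2) \<subseteq> f ` polydisk)"
proof -
  define n where "n = real CARD('n)"
  \<comment> \<open>\<open>K\<close> and \<open>R\<close> repeat the locale constants
    \<open>B\<close> and \<open>r\<close> in terms of n and \<open>\<alpha>\<close> only, since
    \<open>s\<close> has to be fixed before any \<open>f\<close> is given.\<close>
  define K where "K = 96 * n * \<alpha> + 144 * n\<^sup>2 * \<alpha>\<^sup>2"
  define R where "R = 1 / (16 * n\<^sup>2 * (n + n * (n + 1) * K))"
  \<comment> \<open>The order is at most \<open>(n + 1) * (2 / R)\<close>, which is exactly
    \<open>1 / s\<close>; moreover \<open>s\<close> and \<open>s / 2\<close> do not exceed the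
    covering radii \<open>R / 2\<close> and \<open>R / 4\<close>.\<close>
  define s where "s = R / (2 * (n + 1))"
  have n: "n \<ge> 2" using assms(1) by (simp add: n_def)
  have "K \<ge> 0" using n assms(2) by (simp add: K_def)
  then have "n + n * (n + 1) * K > 0" using n by (intro add_pos_nonneg) auto
  then have R: "R > 0" using n by (simp add: R_def)
  have s: "s > 0" using n R by (simp add: s_def)
  have "R / (2 * (n + 1)) \<le> R / 2"
    using n R by (intro divide_left_mono) auto
  then have sR: "s \<le> R / 2" by (simp add: s_def)
  have main: "norm (cgrad (jac_det f) 0) \<le> 1 / s \<and> ball 0 (s / 2) \<subseteq> f ` polydisk \<and>
      (\<forall>a. of_nat (CARD('n) + 1) *s a = cgrad (jac_det f) 0 \<longrightarrow>
        ball 0 s \<subseteq> ran (proj_trans a \<circ>\<^sub>m ((Some \<circ> f) |` polydisk)))"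
    if f: "f \<in> schwarz_family \<alpha>" for f :: "complex ^ 'n \<Rightarrow> complex ^ 'n"
  proof -
    interpret normalized_schwarzian f \<alpha>
      using f assms open_polydisk by unfold_locales (auto simp: schwarz_family_def)
    have r: "r = R"
      by (simp add: r_def C_def B_def R_def K_def n_def)
    have "norm (cgrad (jac_det f) 0) = (n + 1) * norm a"
      unfolding cgrad_jac_det_0 norm_cvec_scale norm_of_nat by (simp add: n_def)
    also have "\<dots> \<le> (n + 1) * (2 / R)"
      using norm_a_le n unfolding r by (intro mult_left_mono) auto
    also have "\<dots> = 1 / s"
      using n R by (simp add: s_def)
    finally have "norm (cgrad (jac_det f) 0) \<le> 1 / s" .
    moreover have "ball 0 (s / 2) \<subseteq> f ` polydisk"
      using ball_subset_image subset_ball[of "s / 2" "R / 4" 0] sR unfolding r by auto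
    moreover have "ball 0 s \<subseteq> ran (proj_trans b \<circ>\<^sub>m ((Some \<circ> f) |` polydisk))"
      if "of_nat (CARD('n) + 1) *s b = cgrad (jac_det f) 0" for b
    proof -
      have "b = a"
        using that by (simp add: cgrad_jac_det_0 vec_eq_iff del: of_nat_add of_nat_Suc)
      then show ?thesis
        using ball_subset_ran subset_ball[OF sR, of 0] unfolding r by auto
    qed
    ultimately show ?thesis by blast
  qed
  have le: "family_order (schwarz_family \<alpha> :: (complex ^ 'n \<Rightarrow> complex ^ 'n) set) \<le> ereal (1 / s)"
    unfolding family_order_def using main by (intro SUP_least) auto
  then have "family_order (schwarz_family \<alpha> :: (complex ^ 'n \<Rightarrow> complex ^ 'n) set) < \<infinity>"
    by (rule le_less_trans) simp
  moreover have "\<forall>g \<in> (schwarz_family0 \<alpha> :: (complex ^ 'n \<rightharpoonup> complex ^ 'n) set). ball 0 s \<subseteq> ran g"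
    using main by (force simp: schwarz_family0_def)
  ultimately show ?thesis using s le main by blast
qed

end
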